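(* Let $\theta$ be an action of an inverse semigroup $S$ on a locally compact Hausdorff space $X$. Then the KS-groupoid $S\ltimes X^{\mathrm{KS}}$ is ample if and only if $X$ is totally disconnected.
   Context: An étale groupoid is called ample if its unit space is totally disconnected. The unit space of $S\ltimes X^{\mathrm{KS}}$ is (identified with) $X^{\mathrm{KS}}$. An inverse semigroup is a semigroup $S$ in which every $s$ has a unique $s^*$ with $ss^*s=s$, $s^*ss^*=s^*$; $E(S)$ is its commutative subsemigroup of idempotents; $s\le t$ means $ts^*s=s$. An action $\theta$ of $S$ on a topological space $X$ is a semigroup homomorphism $s\mapsto\theta_s$ from $S$ to the inverse semigroup of partial bijections of $X$ (bijections between subsets, composed on the largest possible domain) such that, writing $X_e$ for the subset on which $\theta_e$ ($e\in E(S)$) is the identity (so $\theta_s$ is a bijection $X_{s^*s}\to X_{ss^*}$): each $X_e$ is open, each $\theta_s\colon X_{s^*s}\to X_{ss^*}$ is continuous, and $\bigcup_{e\in E(S)}X_e=X$. The space $X^{\mathrm{KS}}$: let $\widetilde{X_e}=X_e\sqcup\{\infty_e\}$ be the one-point compactification of $X_e$ (a point $\infty_e$ is added even when $X_e$ is compact). Let $\widetilde{X^{\mathrm{KS}}}$ be the set of $\tau\in\prod_{e\in E(S)}\widetilde{X_e}$ such that (1) if $e_1\le e_2$ and $\tau(e_1)\ne\infty_{e_1}$, then $\tau(e_2)=\tau(e_1)$; (2) if $\tau(e_1)\neq\infty_{e_1}$ and $\tau(e_2)\neq\infty_{e_2}$, then $\tau(e_1e_2)\neq\infty_{e_1e_2}$;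 with the topology induced from the product topology. Set $X^{\mathrm{KS}}=\widetilde{X^{\mathrm{KS}}}\setminus\{\infty\}$, $\infty=(\infty_e)_e$; it is locally compact Hausdorff. $S$ acts on $X^{\mathrm{KS}}$ by $X^{\mathrm{KS}}_e=\{\tau\in X^{\mathrm{KS}}\mid\tau(e)\ne\infty_e\}$ and $\theta^{\mathrm{KS}}_s\colon X^{\mathrm{KS}}_{s^*s}\to X^{\mathrm{KS}}_{ss^*}$, $\theta^{\mathrm{KS}}_s(\tau)(e)=\theta_{es}(\tau(s^*es))$ if $\tau(s^*es)\neq\infty_{s^*es}$ and $\infty_e$ otherwise. Transformation groupoid: for an action $\theta$ of $S$ on a locally compact Hausdorff space $Z$, $S\ltimes Z$ is the set of classes $[s,z]$ of pairs $(s,z)$, $z\in Z_{s^*s}$, under $(s,z)\sim(t,w)$ iff $z=w$ and $se=te$, $z\in Z_e$ for some $e\in E(S)$; unit space $\{[e,z]\}\cong Z$, $d([s,z])=z$, $r([s,z])=\theta_s(z)$, $[t,\theta_s(z)][s,z]=[ts,z]$, $[s,z]^{-1}=[s^*,\theta_s(z)]$; basis of open sets $[s,U]=\{[s,z]\mid z\in U\}$, $U\subset Z_{s^*s}$ open. It is an étale groupoid. *)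

theory Defs
  imports "HOL-Analysis.Analysis"
begin

class inverse_semigroup = semigroup_mult +
  assumes ex1_star: "\<exists>!t. s * t * s = s \<and> t * s * t = t"

definition star :: "'s::inverse_semigroup \<Rightarrow> 's"  ("_\<^sup>\<star>" [1000] 1000)
  where "s\<^sup>\<star> = (THE t. s * t * s = s \<and> t * s * t = t)"

definition idempotents :: "'s::inverse_semigroup set"
  where "idempotents = {e. e * e = e}"

definition natural_le :: "'s::inverse_semigroup \<Rightarrow> 's \<Rightarrow> bool"  (infix "\<preceq>" 50)
  where "s \<preceq> t \<longleftrightarrow> t * s\<^sup>\<star> * s = s"

(* A partial bijection of X is a partial map (type 'x \<rightharpoonup> 'x) that is injective on its domain;
   map_comp is composition on the largest possible domain. *)

definition partial_bijection :: "'x set \<Rightarrow> ('x \<rightharpoonup> 'x) \<Rightarrow> bool"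
  where "partial_bijection A f \<longleftrightarrow> dom f \<subseteq> A \<and> ran f \<subseteq> A \<and> inj_on f (dom f)"

(* The subset X_e on which \<theta>_e is the identity; used for idempotent e only. *)
definition act_dom :: "('s::inverse_semigroup \<Rightarrow> 'x \<rightharpoonup> 'x) \<Rightarrow> 's \<Rightarrow> 'x set"
  where "act_dom \<theta> e = {x. \<theta> e x = Some x}"

definition inverse_semigroup_action ::
    "'x topology \<Rightarrow> ('s::inverse_semigroup \<Rightarrow> 'x \<rightharpoonup> 'x) \<Rightarrow> bool"
  where "inverse_semigroup_action X \<theta> \<longleftrightarrow>
    (\<forall>s. partial_bijection (topspace X) (\<theta> s)) \<and>
    (\<forall>s t. \<theta> (s * t) = \<theta> s \<circ>\<^sub>m \<theta> t) \<and>
    (\<forall>e\<in>idempotents. openin X (act_dom \<theta> e)) \<and>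
    (\<forall>s. continuous_map (subtopology X (act_dom \<theta> (s\<^sup>\<star> * s)))
                        (subtopology X (act_dom \<theta> (s * s\<^sup>\<star>)))
                        (\<lambda>x. the (\<theta> s x))) \<and>
    (\<Union>e\<in>idempotents. act_dom \<theta> e) = topspace X"

(* The point at infinity of each one-point compactification is None.
   Alexandroff_compactification adds None as an isolated point if the space is compact.
   Points of the product are extensional functions: undefined off idempotents. *)

definition KS_product ::
    "'x topology \<Rightarrow> ('s::inverse_semigroup \<Rightarrow> 'x \<rightharpoonup> 'x) \<Rightarrow> ('s \<Rightarrow> 'x option) topology"
  where "KS_product X \<theta> =
    product_topology (\<lambda>e. Alexandroff_compactification (subtopology X (act_dom \<theta> e))) idempotents"

definition KS_tilde ::
    "'x topology \<Rightarrow> ('s::inverse_semigroup \<Rightarrow> 'x \<rightharpoonup> 'x) \<Rightarrow> ('s \<Rightarrow> 'x option) set"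
  where "KS_tilde X \<theta> = {\<tau> \<in> topspace (KS_product X \<theta>).
    (\<forall>e1\<in>idempotents. \<forall>e2\<in>idempotents. e1 \<preceq> e2 \<and> \<tau> e1 \<noteq> None \<longrightarrow> \<tau> e2 = \<tau> e1) \<and>
    (\<forall>e1\<in>idempotents. \<forall>e2\<in>idempotents. \<tau> e1 \<noteq> None \<and> \<tau> e2 \<noteq> None \<longrightarrow> \<tau> (e1 * e2) \<noteq> None)}"

definition KS_infinity :: "'s::inverse_semigroup \<Rightarrow> 'x option"
  where "KS_infinity = (\<lambda>e\<in>idempotents. None)"

definition KS_space ::
    "'x topology \<Rightarrow> ('s::inverse_semigroup \<Rightarrow> 'x \<rightharpoonup> 'x) \<Rightarrow> ('s \<Rightarrow> 'x option) topology"
  where "KS_space X \<theta> = subtopology (KS_product X \<theta>) (KS_tilde X \<theta> - {KS_infinity})"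

definition KS_action ::
    "'x topology \<Rightarrow> ('s::inverse_semigroup \<Rightarrow> 'x \<rightharpoonup> 'x)
      \<Rightarrow> 's \<Rightarrow> ('s \<Rightarrow> 'x option) \<rightharpoonup> ('s \<Rightarrow> 'x option)"
  where "KS_action X \<theta> s \<tau> =
    (if \<tau> \<in> topspace (KS_space X \<theta>) \<and> \<tau> (s\<^sup>\<star> * s) \<noteq> None
     then Some (\<lambda>e\<in>idempotents.
       (case \<tau> (s\<^sup>\<star> * e * s) of None \<Rightarrow> None | Some x \<Rightarrow> \<theta> (e * s) x))
     else None)"

(* The set of arrows is topspace (Arr G); d and r take values in the unit space, a subset of
   the arrows; Comp G g h is g h and is meaningful only if d(g) = r(h). *)
record 'g top_groupoid =
  Arr :: "'g topology"
  Units :: "'g set"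
  Src :: "'g \<Rightarrow> 'g"
  Rng :: "'g \<Rightarrow> 'g"
  Comp :: "'g \<Rightarrow> 'g \<Rightarrow> 'g"
  Inv :: "'g \<Rightarrow> 'g"

abbreviation arrows :: "'g top_groupoid \<Rightarrow> 'g set"
  where "arrows G \<equiv> topspace (Arr G)"

definition composable :: "'g top_groupoid \<Rightarrow> ('g \<times> 'g) set"
  where "composable G = {(g, h). g \<in> arrows G \<and> h \<in> arrows G \<and> Src G g = Rng G h}"

definition unit_space :: "'g top_groupoid \<Rightarrow> 'g topology"
  where "unit_space G = subtopology (Arr G) (Units G)"

locale groupoid =
  fixes G :: "'g top_groupoid"
  assumes units_subset: "Units G \<subseteq> arrows G"
    and src_in: "g \<in> arrows G \<Longrightarrow> Src G g \<in> Units G"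
    and rng_in: "g \<in> arrows G \<Longrightarrow> Rng G g \<in> Units G"
    and src_unit: "u \<in> Units G \<Longrightarrow> Src G u = u"
    and rng_unit: "u \<in> Units G \<Longrightarrow> Rng G u = u"
    and comp_in: "(g, h) \<in> composable G \<Longrightarrow> Comp G g h \<in> arrows G"
    and src_comp: "(g, h) \<in> composable G \<Longrightarrow> Src G (Comp G g h) = Src G h"
    and rng_comp: "(g, h) \<in> composable G \<Longrightarrow> Rng G (Comp G g h) = Rng G g"
    and comp_assoc: "(g, h) \<in> composable G \<Longrightarrow> (h, k) \<in> composable G \<Longrightarrow>
                       Comp G (Comp G g h) k = Comp G g (Comp G h k)"
    and comp_src: "g \<in> arrows G \<Longrightarrow> Comp G g (Src G g) = g"
    and rng_comp_left: "g \<in> arrows G \<Longrightarrow> Comp G (Rng G g) g = g"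
    and inv_in: "g \<in> arrows G \<Longrightarrow> Inv G g \<in> arrows G"
    and src_inv: "g \<in> arrows G \<Longrightarrow> Src G (Inv G g) = Rng G g"
    and rng_inv: "g \<in> arrows G \<Longrightarrow> Rng G (Inv G g) = Src G g"
    and inv_comp: "g \<in> arrows G \<Longrightarrow> Comp G (Inv G g) g = Src G g"
    and comp_inv: "g \<in> arrows G \<Longrightarrow> Comp G g (Inv G g) = Rng G g"

locale topological_groupoid = groupoid +
  assumes continuous_comp:
      "continuous_map (subtopology (prod_topology (Arr G) (Arr G)) (composable G)) (Arr G)
         (\<lambda>(g, h). Comp G g h)"
    and continuous_inv: "continuous_map (Arr G) (Arr G) (Inv G)"

definition local_homeomorphism :: "'a topology \<Rightarrow> 'b topology \<Rightarrow> ('a \<Rightarrow> 'b) \<Rightarrow> bool"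
  where "local_homeomorphism X Y f \<longleftrightarrow>
    (\<forall>x\<in>topspace X. \<exists>U. openin X U \<and> x \<in> U \<and> openin Y (f ` U) \<and>
       homeomorphic_map (subtopology X U) (subtopology Y (f ` U)) f)"

(* The arrow space need not be Hausdorff. It is automatically locally compact, being locally
   homeomorphic to the unit space. *)
locale etale_groupoid = topological_groupoid +
  assumes locally_compact_units: "locally_compact_space (unit_space G)"
    and Hausdorff_units: "Hausdorff_space (unit_space G)"
    and local_homeomorphism_src: "local_homeomorphism (Arr G) (unit_space G) (Src G)"
    and local_homeomorphism_rng: "local_homeomorphism (Arr G) (unit_space G) (Rng G)"

definition totally_disconnected_space :: "'a topology \<Rightarrow> bool"
  where "totally_disconnected_space X \<longleftrightarrow> (\<forall>C. connectedin X C \<longrightarrow> (\<exists>x. C \<subseteq> {x}))"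

locale ample_groupoid = etale_groupoid +
  assumes totally_disconnected_units: "totally_disconnected_space (unit_space G)"

definition germ_rel ::
    "('s::inverse_semigroup \<Rightarrow> 'z \<rightharpoonup> 'z) \<Rightarrow> (('s \<times> 'z) \<times> ('s \<times> 'z)) set"
  where "germ_rel \<theta> = {((s, z), (t, w)).
    z \<in> act_dom \<theta> (s\<^sup>\<star> * s) \<and> w \<in> act_dom \<theta> (t\<^sup>\<star> * t) \<and>
    z = w \<and> (\<exists>e\<in>idempotents. s * e = t * e \<and> z \<in> act_dom \<theta> e)}"

(* The class [s,z]; empty unless z lies in the domain of \<theta>_s. *)
definition germ :: "('s::inverse_semigroup \<Rightarrow> 'z \<rightharpoonup> 'z) \<Rightarrow> 's \<Rightarrow> 'z \<Rightarrow> ('s \<times> 'z) set"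
  where "germ \<theta> s z = germ_rel \<theta> `` {(s, z)}"

(* The topology is generated by the sets [s,U] = germ \<theta> s ` U. They form a base because
   [s,U] \<inter> [t,V] is the union of the sets [s e, U \<inter> V \<inter> Z_e] over idempotents e with s e = t e.
   A point z of Z corresponds to the unit [e,z], where e is any idempotent with z in Z_e, so that
   d([s,z]) = z and r([s,z]) = \<theta>_s(z) become [s* s, z] and [s s*, \<theta>_s(z)]. *)
definition transformation_groupoid ::
    "'z topology \<Rightarrow> ('s::inverse_semigroup \<Rightarrow> 'z \<rightharpoonup> 'z) \<Rightarrow> ('s \<times> 'z) set top_groupoid"
  where "transformation_groupoid Z \<theta> = \<lparr>
    Arr = topology_generated_by
            {germ \<theta> s ` U | s U. openin Z U \<and> U \<subseteq> act_dom \<theta> (s\<^sup>\<star> * s)},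
    Units = {germ \<theta> e z | e z. e \<in> idempotents \<and> z \<in> act_dom \<theta> e},
    Src = (\<lambda>\<gamma>. THE u. \<exists>s z. (s, z) \<in> \<gamma> \<and> u = germ \<theta> (s\<^sup>\<star> * s) z),
    Rng = (\<lambda>\<gamma>. THE u. \<exists>s z. (s, z) \<in> \<gamma> \<and> u = germ \<theta> (s * s\<^sup>\<star>) (the (\<theta> s z))),
    Comp = (\<lambda>\<gamma> \<delta>. THE \<eta>. \<exists>t s z. (t, the (\<theta> s z)) \<in> \<gamma> \<and> (s, z) \<in> \<delta> \<and> \<eta> = germ \<theta> (t * s) z),
    Inv = (\<lambda>\<gamma>. THE \<eta>. \<exists>s z. (s, z) \<in> \<gamma> \<and> \<eta> = germ \<theta> (s\<^sup>\<star>) (the (\<theta> s z)))\<rparr>"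

definition KS_groupoid ::
    "'x topology \<Rightarrow> ('s::inverse_semigroup \<Rightarrow> 'x \<rightharpoonup> 'x)
      \<Rightarrow> ('s \<times> ('s \<Rightarrow> 'x option)) set top_groupoid"
  where "KS_groupoid X \<theta> = transformation_groupoid (KS_space X \<theta>) (KS_action X \<theta>)"

end

theory Submission
  imports Defs
begin

text \<open>
  For an action on a locally compact Hausdorff space \<open>Z\<close> the transformation groupoid is etale, and
  \<open>z \<mapsto> [e,z]\<close>, with \<open>e\<close> any idempotent such that \<open>z \<in> Z\<^sub>e\<close>, is a homeomorphism from \<open>Z\<close> onto its unit
  space.  Hence it is ample iff \<open>Z\<close> is totally disconnected (\<open>ample_transformation_groupoid_iff\<close>).  Both
  facts rest on one description of the arrow space: a set \<open>W\<close> of arrows is open iff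
  \<open>{z \<in> Z\<^bsub>s* s\<^esub> | [s,z] \<in> W}\<close> is open for each \<open>s\<close> (\<open>openin_Arr_iff\<close>).  So continuity on the arrow
  space is checked along the maps \<open>z \<mapsto> [s,z]\<close>, which are homeomorphisms onto open sets.

  To apply this to \<open>X\<^sup>K\<^sup>S\<close>, one needs that it is locally compact Hausdorff and that \<open>S\<close> acts on it.  The
  first holds because \<open>X\<^sup>K\<^sup>S\<close> is a closed subset of a compact Hausdorff product with one point removed
  (\<open>closedin_KS_tilde\<close>).  In the second only the continuity of \<open>\<theta>\<^sub>s\<close> at points some of whose
  coordinates are infinite is not formal (\<open>continuous_map_transported_coordinate\<close>).  Both use the same
  device: near finite coordinates \<open>\<tau>(e)\<close> and \<open>\<tau>(f)\<close> one finds compact neighbourhoods \<open>K \<subseteq> X\<^sub>e\<close>, \<open>L \<subseteq> X\<^sub>f\<close>,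
  and \<open>K \<inter> L\<close> is then a compact subset of \<open>X\<^bsub>ef\<^esub>\<close>, so that being outside of it is a neighbourhood of
  infinity in the coordinate \<open>ef\<close>.

  It remains to compare \<open>X\<^sup>K\<^sup>S\<close> with \<open>X\<close>.  If \<open>X\<close> is totally disconnected, it has a base of compact open
  sets.  A compact open \<open>K \<subseteq> X\<^sub>e\<close> is clopen in the one-point compactification of \<open>X\<^sub>e\<close>, so two points of
  \<open>X\<^sup>K\<^sup>S\<close> that differ in the coordinate \<open>e\<close> are separated by a clopen set.  Conversely, the coordinate maps
  \<open>\<tau> \<mapsto> \<tau>(e)\<close> onto \<open>X\<^sub>e\<close> do not help, since a continuous image of a totally disconnected space can be
  connected; but they have continuous sections.  Sending \<open>x \<in> X\<^sub>e\<close> to the point with value \<open>x\<close> at all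
  \<open>f \<ge> e\<close> and infinity elsewhere embeds \<open>X\<^sub>e\<close> in \<open>X\<^sup>K\<^sup>S\<close>.  So each \<open>X\<^sub>e\<close> is totally disconnected, and since
  these open sets cover the locally compact Hausdorff space \<open>X\<close>, so is \<open>X\<close>.
\<close>

section \<open>Inverse semigroups\<close>

lemma star_inverse: "s * s\<^sup>\<star> * s = s" "s\<^sup>\<star> * s * s\<^sup>\<star> = s\<^sup>\<star>"
  using theI'[OF ex1_star[of s]] unfolding star_def by auto

lemma star_inverse_left: "s * (s\<^sup>\<star> * s) = s" "s\<^sup>\<star> * (s * s\<^sup>\<star>) = s\<^sup>\<star>"
  using star_inverse[of s] by (simp_all add: mult.assoc)

lemma star_cancel: "s * (s\<^sup>\<star> * (s * x)) = s * x" "s\<^sup>\<star> * (s * (s\<^sup>\<star> * x)) = s\<^sup>\<star> * x"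
  by (metis mult.assoc star_inverse)+

lemma star_eqI:
  assumes "s * t * s = s" "t * s * t = t"
  shows "s\<^sup>\<star> = t"
  using ex1_star[of s] star_inverse[of s] assms by blast

lemma star_star [simp]: "(s\<^sup>\<star>)\<^sup>\<star> = s"
  by (rule star_eqI) (simp_all add: star_inverse)

lemma idempotent_mult_self: "e \<in> idempotents \<Longrightarrow> e * e = e"
  by (simp add: idempotents_def)

lemma idempotent_mult_cancel: "e \<in> idempotents \<Longrightarrow> e * (e * x) = e * x"
  by (metis idempotent_mult_self mult.assoc)

lemma star_idempotent: "e \<in> idempotents \<Longrightarrow> e\<^sup>\<star> = e"
  by (rule star_eqI) (simp_all add: idempotent_mult_self)

lemma star_mult_idempotent: "s\<^sup>\<star> * s \<in> idempotents" "s * s\<^sup>\<star> \<in> idempotents"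
  by (simp_all add: idempotents_def star_cancel mult.assoc star_inverse_left)

text \<open>With \<open>x = (e f)\<^sup>\<star>\<close>, the element \<open>f x e\<close> is also an inverse of \<open>e f\<close>, hence equals \<open>x\<close>, and
  it is visibly idempotent; so \<open>e f = x\<^sup>\<star> = x\<close> is idempotent too.\<close>

lemma idempotent_mult:
  assumes e: "e \<in> idempotents" and f: "f \<in> idempotents"
  shows "e * f \<in> idempotents"
proof -
  define x where "x = (e * f)\<^sup>\<star>"
  note cancel = idempotent_mult_cancel[OF e] idempotent_mult_cancel[OF f]
  have x: "e * f * x * (e * f) = e * f" "x * (e * f) * x = x"
    using star_inverse[of "e * f"] by (simp_all add: x_def)
  have x': "x * (e * (f * (x * y))) = x * y" for y
    by (metis x(2) mult.assoc)
  have "x = f * x * e"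
    unfolding x_def
  proof (rule star_eqI, fold x_def)
    show "e * f * (f * x * e) * (e * f) = e * f"
      using x(1) by (simp add: mult.assoc cancel)
    show "f * x * e * (e * f) * (f * x * e) = f * x * e"
      by (simp add: mult.assoc cancel x')
  qed
  then have "x * x = x"
    by (metis (no_types, lifting) mult.assoc x(2))
  then have "x \<in> idempotents"
    by (simp add: idempotents_def)
  moreover have "x\<^sup>\<star> = e * f"
    by (simp add: x_def)
  ultimately show ?thesis
    using star_idempotent by metis
qed

lemma idempotent_commute:
  assumes e: "e \<in> idempotents" and f: "f \<in> idempotents"
  shows "e * f = f * e"
proof -
  note cancel = idempotent_mult_cancel[OF e] idempotent_mult_cancel[OF f]
  have "(e * f) * (e * f) = e * f" "(f * e) * (f * e) = f * e"
    by (rule idempotent_mult_self[OF idempotent_mult], (rule e f)+)+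
  then have "(e * f)\<^sup>\<star> = f * e"
    by (intro star_eqI) (simp_all add: mult.assoc cancel)
  then show ?thesis
    using star_idempotent[OF idempotent_mult[OF e f]] by simp
qed

lemma star_mult: "(s * t)\<^sup>\<star> = t\<^sup>\<star> * s\<^sup>\<star>"
proof (rule star_eqI)
  have c: "(t * t\<^sup>\<star>) * (s\<^sup>\<star> * s) = (s\<^sup>\<star> * s) * (t * t\<^sup>\<star>)"
    by (rule idempotent_commute) (rule star_mult_idempotent)+
  have "s * t * (t\<^sup>\<star> * s\<^sup>\<star>) * (s * t) = s * ((t * t\<^sup>\<star>) * (s\<^sup>\<star> * s)) * t"
    by (simp add: mult.assoc)
  also have "\<dots> = s * t"
    unfolding c by (simp add: mult.assoc star_cancel star_inverse_left)
  finally show "s * t * (t\<^sup>\<star> * s\<^sup>\<star>) * (s * t) = s * t" .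
  have "t\<^sup>\<star> * s\<^sup>\<star> * (s * t) * (t\<^sup>\<star> * s\<^sup>\<star>) = t\<^sup>\<star> * ((s\<^sup>\<star> * s) * (t * t\<^sup>\<star>)) * s\<^sup>\<star>"
    by (simp add: mult.assoc)
  also have "\<dots> = t\<^sup>\<star> * s\<^sup>\<star>"
    unfolding c[symmetric] by (simp add: mult.assoc star_cancel star_inverse_left)
  finally show "t\<^sup>\<star> * s\<^sup>\<star> * (s * t) * (t\<^sup>\<star> * s\<^sup>\<star>) = t\<^sup>\<star> * s\<^sup>\<star>" .
qed

text \<open>This is how idempotents are moved past \<open>s s\<^sup>\<star>\<close>; the two forms are those that arise once products
  are associated to the right.\<close>

lemma idempotent_star_shift:
  assumes "e \<in> idempotents"
  shows "s * (s\<^sup>\<star> * (e * x)) = e * (s * (s\<^sup>\<star> * x))"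
    and "s * (s\<^sup>\<star> * e) = e * (s * s\<^sup>\<star>)"
proof -
  have c: "s * s\<^sup>\<star> * e = e * (s * s\<^sup>\<star>)"
    using idempotent_commute[OF assms star_mult_idempotent(2)[of s]] by simp
  show "s * (s\<^sup>\<star> * e) = e * (s * s\<^sup>\<star>)"
    using c by (simp add: mult.assoc)
  show "s * (s\<^sup>\<star> * (e * x)) = e * (s * (s\<^sup>\<star> * x))"
    using arg_cong[OF c, of "\<lambda>u. u * x"] by (simp add: mult.assoc)
qed

text \<open>Conjugation by \<open>s\<close> is multiplicative on idempotents because the factor \<open>s s\<^sup>\<star>\<close> in the middle
  commutes past \<open>e\<close> and is absorbed by \<open>s\<^sup>\<star>\<close>.\<close>

lemma conjugate_mult:
  assumes "e \<in> idempotents"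
  shows "(s\<^sup>\<star> * e * s) * (s\<^sup>\<star> * f * s) = s\<^sup>\<star> * (e * f) * s"
  by (metis (no_types, lifting) mult.assoc assms idempotent_star_shift(2) star_inverse(2))

lemma conjugate_idempotent:
  assumes "e \<in> idempotents"
  shows "s\<^sup>\<star> * e * s \<in> idempotents"
  using conjugate_mult[OF assms, of s e] assms by (simp add: idempotents_def)

lemma natural_le_idempotent:
  assumes "e \<in> idempotents"
  shows "e \<preceq> f \<longleftrightarrow> f * e = e"
  using assms by (simp add: natural_le_def star_idempotent idempotent_mult_self mult.assoc)

section \<open>Actions of inverse semigroups\<close>

locale action =
  fixes Z :: "'z topology" and \<theta> :: "'s::inverse_semigroup \<Rightarrow> 'z \<rightharpoonup> 'z"
  assumes action: "inverse_semigroup_action Z \<theta>"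
begin

lemma act_range: "\<theta> s z = Some w \<Longrightarrow> z \<in> topspace Z \<and> w \<in> topspace Z"
  using action unfolding inverse_semigroup_action_def partial_bijection_def
  by (metis domI ranI subsetD)

lemma act_inj: "\<theta> s z = Some w \<Longrightarrow> \<theta> s z' = Some w \<Longrightarrow> z = z'"
  using action unfolding inverse_semigroup_action_def partial_bijection_def inj_on_def
  by (metis domI)

lemma act_mult: "\<theta> (s * t) z = (case \<theta> t z of None \<Rightarrow> None | Some w \<Rightarrow> \<theta> s w)"
  using action unfolding inverse_semigroup_action_def by (simp add: map_comp_def)

lemma openin_act_dom: "e \<in> idempotents \<Longrightarrow> openin Z (act_dom \<theta> e)"
  using action unfolding inverse_semigroup_action_def by blast

text \<open>A map with \<open>\<theta>\<^sub>e \<circ> \<theta>\<^sub>e = \<theta>\<^sub>e\<close> sends \<open>z\<close> and \<open>w = \<theta>\<^sub>e z\<close> to the same point, so injectivity makes it a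
  partial identity.\<close>

lemma act_idempotent:
  assumes "e \<in> idempotents" "\<theta> e z = Some w"
  shows "w = z"
proof -
  have "\<theta> e w = Some w"
    using act_mult[of e e z] assms by (simp add: idempotent_mult_self)
  with assms show ?thesis
    using act_inj by blast
qed

lemma act_dom_idempotent: "e \<in> idempotents \<Longrightarrow> z \<in> act_dom \<theta> e \<longleftrightarrow> \<theta> e z \<noteq> None"
  using act_idempotent by (auto simp: act_dom_def)

text \<open>This trades the domain \<open>Z\<^bsub>s* s\<^esub>\<close> for plain definedness of \<open>\<theta>\<^sub>s\<close>, the form in which it is used
  throughout.\<close>

lemma act_dom_iff: "z \<in> act_dom \<theta> (s\<^sup>\<star> * s) \<longleftrightarrow> \<theta> s z \<noteq> None"
proof -
  have "\<theta> s z = \<theta> (s * (s\<^sup>\<star> * s)) z"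
    by (simp add: star_inverse_left)
  then show ?thesis
    unfolding act_dom_idempotent[OF star_mult_idempotent(1)] act_mult[of s "s\<^sup>\<star> * s"]
    by (auto simp: act_mult[of "s\<^sup>\<star>"] split: option.splits)
qed

lemma act_star: "\<theta> s z = Some w \<Longrightarrow> \<theta> (s\<^sup>\<star>) w = Some z"
  using act_dom_iff[of z s] by (auto simp: act_dom_def act_mult)

lemma act_star_iff: "\<theta> (s\<^sup>\<star>) w = Some z \<longleftrightarrow> \<theta> s z = Some w"
  using act_star[of s z w] act_star[of "s\<^sup>\<star>" w z] by auto

lemma act_dom_range: "\<theta> s z = Some w \<Longrightarrow> w \<in> act_dom \<theta> (s * s\<^sup>\<star>)"
  by (simp add: act_dom_def act_mult act_star)

lemma act_dom_mult:
  assumes "e \<in> idempotents" "f \<in> idempotents"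
  shows "act_dom \<theta> (e * f) = act_dom \<theta> e \<inter> act_dom \<theta> f"
  using assms act_idempotent
  by (auto simp: act_dom_idempotent[OF idempotent_mult[OF assms]] act_dom_idempotent act_mult
      split: option.splits) metis+

lemma act_dom_subset: "act_dom \<theta> e \<subseteq> topspace Z"
  using act_range by (auto simp: act_dom_def)

lemma act_dom_conjugate:
  assumes "e \<in> idempotents"
  shows "z \<in> act_dom \<theta> (s\<^sup>\<star> * e * s) \<longleftrightarrow> (\<exists>w. \<theta> s z = Some w \<and> w \<in> act_dom \<theta> e)"
  using act_idempotent[OF assms] act_star
  by (auto simp: act_dom_idempotent[OF conjugate_idempotent[OF assms]] act_dom_idempotent[OF assms]
      act_mult split: option.splits) (metis not_Some_eq)+

lemma continuous_act:
  "continuous_map (subtopology Z (act_dom \<theta> (s\<^sup>\<star> * s))) Z (\<lambda>z. the (\<theta> s z))"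
  using action unfolding inverse_semigroup_action_def
  by (meson continuous_map_into_fulltopology)

lemma action_covers: "z \<in> topspace Z \<Longrightarrow> \<exists>e\<in>idempotents. z \<in> act_dom \<theta> e"
  using action unfolding inverse_semigroup_action_def by blast

end

section \<open>Totally disconnected locally compact spaces\<close>

text \<open>The component of \<open>x\<close> is \<open>{x}\<close>, which is compact, so in a locally compact Hausdorff space it has
  arbitrarily small clopen neighbourhoods; inside a compact neighbourhood these are compact.\<close>

lemma totally_disconnected_imp_compact_open_base:
  assumes lc: "locally_compact_space X" and H: "Hausdorff_space X"
    and td: "totally_disconnected_space X" and W: "openin X W" "x \<in> W"
  obtains K where "compactin X K" "openin X K" "x \<in> K" "K \<subseteq> W"
proof -
  have x: "x \<in> topspace X"
    using W openin_subset by blast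
  obtain U L where UL: "openin X U" "compactin X L" "x \<in> U" "U \<subseteq> L" "L \<subseteq> W"
    using lc W unfolding locally_compact_space_neighbourhood_base_closedin[OF disjI1[OF H]]
    unfolding neighbourhood_base_of by meson
  have "connected_component_of_set X x \<subseteq> {x}"
    using td x connectedin_connected_component_of[of X x] connected_component_of_refl[of X x]
    unfolding totally_disconnected_space_def by (metis mem_Collect_eq singletonD subsetD)
  then have "{x} \<in> connected_components_of X"
    using x connected_component_in_connected_components_of connected_component_of_refl
    by (metis empty_iff mem_Collect_eq subset_singleton_iff)
  then obtain K V where KV: "openin X K" "openin X V" "disjnt K V" "K \<union> V = topspace X"
      "{x} \<subseteq> K" "K \<subseteq> U"
    using wilder_locally_compact_component_thm[OF lc H, of "{x}" U] UL x by (metis bot_least compactin_sing insert_subset)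
  have "K = topspace X - V"
    using KV(3,4) by (auto simp: disjnt_iff)
  then have "closedin X K"
    using KV(2) by blast
  then have "compactin X K"
    using closed_compactin UL KV by (metis subset_trans)
  with KV UL show ?thesis
    by (intro that[of K]) auto
qed

text \<open>A clopen subset of a member \<open>U\<close> of the cover is open in \<open>X\<close> but need not be closed there.  A compact
  open subset of \<open>U\<close> is, so it separates points of \<open>X\<close>.\<close>

lemma totally_disconnected_space_openin_cover:
  assumes lc: "locally_compact_space X" and H: "Hausdorff_space X"
    and open_cover: "\<And>U. U \<in> \<U> \<Longrightarrow> openin X U" "topspace X \<subseteq> \<Union>\<U>"
    and td: "\<And>U. U \<in> \<U> \<Longrightarrow> totally_disconnected_space (subtopology X U)"
  shows "totally_disconnected_space X"
  unfolding totally_disconnected_space_def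
proof (intro allI impI)
  fix C assume C: "connectedin X C"
  have "x = y" if "x \<in> C" "y \<in> C" for x y
  proof (rule ccontr)
    assume "x \<noteq> y"
    have xy: "x \<in> topspace X" "y \<in> topspace X"
      using C that connectedin_subset_topspace by blast+
    then obtain U where U: "U \<in> \<U>" "x \<in> U"
      using open_cover by blast
    then have o: "openin X U"
      using open_cover by blast
    (* Only x is known to lie in U.  Removing y handles both possibilities for y. *)
    have "openin X (U - {y})"
      using o H by (simp add: openin_diff closedin_Hausdorff_sing_eq xy)
    then have "openin (subtopology X U) (U - {y})"
      by (simp add: openin_open_subtopology o)
    then obtain K where K: "compactin (subtopology X U) K" "openin (subtopology X U) K" "x \<in> K"
        "K \<subseteq> U - {y}"
      using totally_disconnected_imp_compact_open_base[of "subtopology X U" "U - {y}" x]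
        locally_compact_space_open_subset[OF disjI1[OF H] lc o] Hausdorff_space_subtopology[OF H]
        td[OF U(1)] U \<open>x \<noteq> y\<close> by blast
    then have "openin X K" "closedin X K"
      using o by (auto simp: openin_open_subtopology compactin_subtopology intro: compactin_imp_closedin[OF H])
    then show False
      using connectedin_clopen_cases[OF C] K that by (metis Diff_iff disjnt_iff singletonI subsetD)
  qed
  then show "\<exists>x. C \<subseteq> {x}"
    by blast
qed

lemma totally_disconnected_space_inj_preimage:
  assumes f: "continuous_map X Y f" "inj_on f (topspace X)" and Y: "totally_disconnected_space Y"
  shows "totally_disconnected_space X"
  unfolding totally_disconnected_space_def
proof (intro allI impI)
  fix C assume C: "connectedin X C"
  then obtain y where "f ` C \<subseteq> {y}"
    using connectedin_continuous_map_image[OF f(1)] Y unfolding totally_disconnected_space_def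
    by blast
  then have "x = x'" if "x \<in> C" "x' \<in> C" for x x'
    using that f(2) connectedin_subset_topspace[OF C] by (metis image_eqI inj_onD singletonD subsetD)
  then show "\<exists>x. C \<subseteq> {x}"
    by blast
qed

context action
begin

section \<open>Germs\<close>

lemma mem_germ_iff:
  "(t, w) \<in> germ \<theta> s z \<longleftrightarrow> \<theta> s z \<noteq> None \<and> \<theta> t w \<noteq> None \<and> w = z
     \<and> (\<exists>e\<in>idempotents. s * e = t * e \<and> z \<in> act_dom \<theta> e)"
  by (auto simp: germ_def germ_rel_def act_dom_iff)

lemma mem_germ_self: "\<theta> s z \<noteq> None \<Longrightarrow> (s, z) \<in> germ \<theta> s z"
  unfolding mem_germ_iff using act_dom_iff star_mult_idempotent(1) by blast

text \<open>The idempotent \<open>e\<close> witnessing that \<open>s\<close> and \<open>t\<close> agree near \<open>z\<close> and the idempotent \<open>f\<close> for \<open>s\<close> and \<open>u\<close>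
  combine to \<open>e f\<close>, a witness for \<open>t\<close> and \<open>u\<close>; here idempotents must commute.\<close>

lemma germ_eqI:
  assumes "e \<in> idempotents" "s * e = t * e" "z \<in> act_dom \<theta> e" "\<theta> s z \<noteq> None" "\<theta> t z \<noteq> None"
  shows "germ \<theta> s z = germ \<theta> t z"
proof -
  have "(u, w) \<in> germ \<theta> t z" if tt: "(u, w) \<in> germ \<theta> s z" "\<theta> t z \<noteq> None"
    "s * e = t * e" for u w s t
  proof -
    obtain f where f: "f \<in> idempotents" "s * f = u * f" "z \<in> act_dom \<theta> f" "w = z"
        "\<theta> u w \<noteq> None"
      using tt(1) by (auto simp: mem_germ_iff)
    have "t * (e * f) = s * f * e"
      using tt(3) idempotent_commute[OF assms(1) f(1)] by (metis mult.assoc)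
    also have "\<dots> = u * (e * f)"
      using f(2) idempotent_commute[OF assms(1) f(1)] by (metis mult.assoc)
    finally show ?thesis
      using f tt(2) assms(3) idempotent_mult[OF assms(1) f(1)] act_dom_mult[OF assms(1) f(1)]
      by (auto simp: mem_germ_iff intro!: bexI[of _ "e * f"])
  qed
  from this[of _ _ s t] this[of _ _ t s] show ?thesis
    using assms by auto
qed

lemma germ_eq_iff:
  assumes "\<theta> s z \<noteq> None" "\<theta> t w \<noteq> None"
  shows "germ \<theta> s z = germ \<theta> t w \<longleftrightarrow>
    z = w \<and> (\<exists>e\<in>idempotents. s * e = t * e \<and> z \<in> act_dom \<theta> e)"
  using assms mem_germ_self[of t w] mem_germ_iff[of t w s z] germ_eqI[of _ s t z] by metis

lemma mem_germ_imp_eq: "(t, w) \<in> germ \<theta> s z \<Longrightarrow> w = z \<and> germ \<theta> t z = germ \<theta> s z \<and> \<theta> s z \<noteq> None \<and> \<theta> t z \<noteq> None"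
  using mem_germ_iff[of t w s z] germ_eqI[of _ s t z] by blast

lemma germ_eq_imp_act_eq:
  assumes "germ \<theta> s z = germ \<theta> t z" "\<theta> s z \<noteq> None" "\<theta> t z \<noteq> None"
  shows "\<theta> s z = \<theta> t z"
proof -
  obtain e where e: "s * e = t * e" "z \<in> act_dom \<theta> e"
    using assms germ_eq_iff by blast
  then have "\<theta> e z = Some z"
    by (simp add: act_dom_def)
  then show ?thesis
    using arg_cong[OF e(1), of "\<lambda>u. \<theta> u z"] by (simp add: act_mult)
qed

lemma mem_germ_imp_act_eq: "(t, w) \<in> germ \<theta> s z \<Longrightarrow> \<theta> t w = \<theta> s z"
  using mem_germ_imp_eq germ_eq_imp_act_eq by blast

text \<open>The point \<open>z\<close> of \<open>Z\<close> below the arrow \<open>[s,z]\<close>.\<close>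

definition base_point :: "('s \<times> 'z) set \<Rightarrow> 'z"
  where "base_point \<gamma> = snd (SOME p. p \<in> \<gamma>)"

lemma base_point_germ: "\<theta> s z \<noteq> None \<Longrightarrow> base_point (germ \<theta> s z) = z"
  unfolding base_point_def using someI[of "\<lambda>p. p \<in> germ \<theta> s z", OF mem_germ_self]
  by (metis mem_germ_imp_eq prod.collapse)

text \<open>The unit \<open>[e,z]\<close> at \<open>z\<close>; it does not depend on the idempotent \<open>e\<close> with \<open>z \<in> Z\<^sub>e\<close>.\<close>

definition unit_germ :: "'z \<Rightarrow> ('s \<times> 'z) set"
  where "unit_germ z = germ \<theta> (SOME e. e \<in> idempotents \<and> z \<in> act_dom \<theta> e) z"

lemma germ_idempotent_eq_unit_germ:
  assumes "e \<in> idempotents" "z \<in> act_dom \<theta> e"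
  shows "germ \<theta> e z = unit_germ z"
proof -
  define f where "f = (SOME e. e \<in> idempotents \<and> z \<in> act_dom \<theta> e)"
  have f: "f \<in> idempotents" "z \<in> act_dom \<theta> f"
    using someI[of "\<lambda>e. e \<in> idempotents \<and> z \<in> act_dom \<theta> e" e] assms by (auto simp: f_def)
  have "germ \<theta> e z = germ \<theta> f z"
  proof (rule germ_eqI)
    show "e * (e * f) = f * (e * f)"
      using idempotent_commute[OF assms(1) f(1)] idempotent_mult_cancel[OF assms(1), of f]
        idempotent_mult_cancel[OF f(1), of e] by simp
  qed (use assms f in \<open>auto simp: idempotent_mult act_dom_def act_mult\<close>)
  then show ?thesis
    by (simp add: unit_germ_def f_def)
qed

lemma germ_star_mult_eq_unit_germ: "\<theta> s z \<noteq> None \<Longrightarrow> germ \<theta> (s\<^sup>\<star> * s) z = unit_germ z"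
  using germ_idempotent_eq_unit_germ star_mult_idempotent(1) act_dom_iff by blast

lemma germ_mult_star_eq_unit_germ: "\<theta> s z = Some w \<Longrightarrow> germ \<theta> (s * s\<^sup>\<star>) w = unit_germ w"
  using germ_idempotent_eq_unit_germ star_mult_idempotent(2) act_dom_range by blast

lemma unit_germ_idempotent:
  assumes "z \<in> topspace Z"
  obtains e where "e \<in> idempotents" "z \<in> act_dom \<theta> e" "\<theta> e z = Some z" "unit_germ z = germ \<theta> e z"
proof -
  obtain e where e: "e \<in> idempotents" "z \<in> act_dom \<theta> e"
    using action_covers[OF assms] by blast
  then show ?thesis
    using germ_idempotent_eq_unit_germ[OF e] by (intro that[of e]) (auto simp: act_dom_def)
qed

lemma base_point_unit_germ: "z \<in> topspace Z \<Longrightarrow> base_point (unit_germ z) = z"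
  by (erule unit_germ_idempotent) (simp add: base_point_germ)

section \<open>The algebra of the transformation groupoid\<close>

abbreviation G where "G \<equiv> transformation_groupoid Z \<theta>"

lemma arrows_transformation_groupoid: "arrows G = {germ \<theta> s z | s z. \<theta> s z \<noteq> None}"
proof -
  have "germ \<theta> s z \<in> \<Union> {germ \<theta> s ` U |s U. openin Z U \<and> U \<subseteq> act_dom \<theta> (s\<^sup>\<star> * s)}"
    if "\<theta> s z \<noteq> None" for s z
    using openin_act_dom[OF star_mult_idempotent(1)[of s]] that act_dom_iff[of z s] by blast
  then show ?thesis
    using act_dom_iff by (auto simp: transformation_groupoid_def) blast+
qed

lemma arrowE:
  assumes "\<gamma> \<in> arrows G"
  obtains s z w where "\<theta> s z = Some w" "\<gamma> = germ \<theta> s z"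
  using assms by (auto simp: arrows_transformation_groupoid)

lemma germ_in_arrows: "\<theta> s z = Some w \<Longrightarrow> germ \<theta> s z \<in> arrows G"
  by (auto simp: arrows_transformation_groupoid)

lemma unit_germ_in_arrows: "z \<in> topspace Z \<Longrightarrow> unit_germ z \<in> arrows G"
  by (erule unit_germ_idempotent) (simp add: germ_in_arrows)

lemma Units_transformation_groupoid: "Units G = unit_germ ` topspace Z"
proof -
  have "Units G = {germ \<theta> e z | e z. e \<in> idempotents \<and> z \<in> act_dom \<theta> e}"
    by (simp add: transformation_groupoid_def)
  also have "\<dots> = unit_germ ` topspace Z"
  proof (intro set_eqI iffI)
    fix u assume "u \<in> {germ \<theta> e z | e z. e \<in> idempotents \<and> z \<in> act_dom \<theta> e}"
    then show "u \<in> unit_germ ` topspace Z"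
      using germ_idempotent_eq_unit_germ act_dom_subset by blast
  next
    fix u assume "u \<in> unit_germ ` topspace Z"
    then obtain z where "z \<in> topspace Z" "u = unit_germ z"
      by blast
    then show "u \<in> {germ \<theta> e z | e z. e \<in> idempotents \<and> z \<in> act_dom \<theta> e}"
      by (auto elim!: unit_germ_idempotent)
  qed
  finally show ?thesis .
qed

lemma Src_germ:
  assumes "\<theta> s z \<noteq> None" shows "Src G (germ \<theta> s z) = unit_germ z"
  unfolding transformation_groupoid_def top_groupoid.simps
proof (rule the_equality)
  show "\<exists>s' z'. (s', z') \<in> germ \<theta> s z \<and> unit_germ z = germ \<theta> (s'\<^sup>\<star> * s') z'"
    using assms mem_germ_self[of s z] germ_star_mult_eq_unit_germ[OF assms] by force
  show "u = unit_germ z" if "\<exists>s' z'. (s', z') \<in> germ \<theta> s z \<and> u = germ \<theta> (s'\<^sup>\<star> * s') z'" for u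
    using that mem_germ_imp_eq germ_star_mult_eq_unit_germ by blast
qed

lemma Rng_germ:
  assumes "\<theta> s z = Some w" shows "Rng G (germ \<theta> s z) = unit_germ w"
  unfolding transformation_groupoid_def top_groupoid.simps
proof (rule the_equality)
  show "\<exists>s' z'. (s', z') \<in> germ \<theta> s z \<and> unit_germ w = germ \<theta> (s' * s'\<^sup>\<star>) (the (\<theta> s' z'))"
    using assms mem_germ_self[of s z] germ_mult_star_eq_unit_germ[OF assms] by force
qed (use assms germ_mult_star_eq_unit_germ mem_germ_imp_act_eq in force)

text \<open>If \<open>s e = t e\<close>, then \<open>s\<^sup>\<star>\<close> and \<open>t\<^sup>\<star>\<close> agree on the transported idempotent \<open>s e s\<^sup>\<star> = t e t\<^sup>\<star>\<close>, whose
  domain contains \<open>\<theta>\<^sub>s z\<close>.\<close>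

lemma germ_star_cong:
  assumes "(t, z') \<in> germ \<theta> s z" "\<theta> s z = Some w"
  shows "germ \<theta> (t\<^sup>\<star>) w = germ \<theta> (s\<^sup>\<star>) w"
proof -
  obtain e where e: "e \<in> idempotents" "s * e = t * e" "z \<in> act_dom \<theta> e" "z' = z"
    using assms(1) by (auto simp: mem_germ_iff)
  define f where "f = (s\<^sup>\<star>)\<^sup>\<star> * e * s\<^sup>\<star>"
  have ft: "f = (t\<^sup>\<star>)\<^sup>\<star> * e * t\<^sup>\<star>"
  proof -
    have eq: "u * e * u\<^sup>\<star> = (u * e) * (u * e)\<^sup>\<star>" for u
      using e(1) by (simp add: star_mult star_idempotent mult.assoc idempotent_mult_cancel)
    show ?thesis
      unfolding f_def star_star eq[of s] eq[of t] unfolding e(2) ..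
  qed
  have et: "\<theta> t z = Some w"
    using mem_germ_imp_act_eq[OF assms(1)] assms(2) e(4) by simp
  have "e * s\<^sup>\<star> = e * t\<^sup>\<star>"
    using arg_cong[OF e(2), of star] e(1) by (simp add: star_mult star_idempotent)
  moreover have shift: "u\<^sup>\<star> * ((u\<^sup>\<star>)\<^sup>\<star> * e * u\<^sup>\<star>) = e * u\<^sup>\<star>" for u
    using idempotent_star_shift(1)[OF e(1), of "u\<^sup>\<star>" "u\<^sup>\<star>"]
    by (simp add: mult.assoc star_inverse_left)
  moreover have "s\<^sup>\<star> * f = e * s\<^sup>\<star>"
    unfolding f_def by (rule shift)
  moreover have "t\<^sup>\<star> * f = e * t\<^sup>\<star>"
    unfolding ft by (rule shift)
  ultimately have "t\<^sup>\<star> * f = s\<^sup>\<star> * f"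
    by simp
  moreover have "w \<in> act_dom \<theta> f"
    unfolding f_def act_dom_conjugate[OF e(1)] using act_star[OF assms(2)] e(3) by auto
  ultimately show ?thesis
    using conjugate_idempotent[OF e(1), of "s\<^sup>\<star>"] act_star[OF assms(2)] act_star[OF et]
    by (intro germ_eqI[of f]) (auto simp: f_def)
qed

lemma Inv_germ:
  assumes "\<theta> s z = Some w" shows "Inv G (germ \<theta> s z) = germ \<theta> (s\<^sup>\<star>) w"
  unfolding transformation_groupoid_def top_groupoid.simps
proof (rule the_equality)
  show "\<exists>s' z'. (s', z') \<in> germ \<theta> s z \<and> germ \<theta> (s\<^sup>\<star>) w = germ \<theta> (s'\<^sup>\<star>) (the (\<theta> s' z'))"
    using assms mem_germ_self[of s z] by force
  show "\<eta> = germ \<theta> (s\<^sup>\<star>) w"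
    if "\<exists>s' z'. (s', z') \<in> germ \<theta> s z \<and> \<eta> = germ \<theta> (s'\<^sup>\<star>) (the (\<theta> s' z'))" for \<eta>
    using that assms germ_star_cong mem_germ_imp_act_eq by force
qed

text \<open>If \<open>t' f = t f\<close> and \<open>s' e = s e\<close>, then \<open>t' s'\<close> and \<open>t s\<close> agree on \<open>e s\<^sup>\<star> f s\<close>, since
  \<open>s (s\<^sup>\<star> f s) = f s\<close>.\<close>

lemma germ_mult_cong:
  assumes "(t', w') \<in> germ \<theta> t w" "(s', z') \<in> germ \<theta> s z" "\<theta> s z = Some w" "\<theta> t w \<noteq> None"
  shows "germ \<theta> (t' * s') z' = germ \<theta> (t * s) z"
proof -
  obtain f where f: "f \<in> idempotents" "t * f = t' * f" "w \<in> act_dom \<theta> f" "w' = w"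
    using assms(1) by (auto simp: mem_germ_iff)
  obtain e where e: "e \<in> idempotents" "s * e = s' * e" "z \<in> act_dom \<theta> e" "z' = z"
    using assms(2) by (auto simp: mem_germ_iff)
  define g where "g = s\<^sup>\<star> * f * s"
  have g: "g \<in> idempotents"
    unfolding g_def by (rule conjugate_idempotent[OF f(1)])
  have sg: "s * g = f * s"
    unfolding g_def by (simp add: mult.assoc idempotent_star_shift(1)[OF f(1)] star_inverse_left)
  have "t' * s' * (e * g) = t' * (s * e) * g"
    by (simp add: e(2) mult.assoc)
  also have "\<dots> = t' * (s * g) * e"
    using idempotent_commute[OF e(1) g] by (simp add: mult.assoc)
  also have "\<dots> = t * (s * g) * e"
    unfolding sg using f(2) by (simp flip: mult.assoc)
  also have "\<dots> = t * s * (e * g)"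
    using idempotent_commute[OF e(1) g] by (simp add: mult.assoc)
  finally have "t' * s' * (e * g) = t * s * (e * g)" .
  moreover have "z \<in> act_dom \<theta> (e * g)"
    using act_dom_mult[OF e(1) g] e(3) act_dom_conjugate[OF f(1)] assms(3) f(3) by (auto simp: g_def)
  moreover have "\<theta> (t * s) z \<noteq> None" "\<theta> (t' * s') z \<noteq> None"
    using assms mem_germ_imp_act_eq[OF assms(1)] mem_germ_imp_act_eq[OF assms(2)] e(4) f(4)
    by (auto simp: act_mult)
  ultimately show ?thesis
    unfolding e(4) by (intro germ_eqI[OF idempotent_mult[OF e(1) g]])
qed

lemma Comp_germ:
  assumes "\<theta> s z = Some w" "\<theta> t w \<noteq> None"
  shows "Comp G (germ \<theta> t w) (germ \<theta> s z) = germ \<theta> (t * s) z"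
  unfolding transformation_groupoid_def top_groupoid.simps
proof (rule the_equality)
  show "\<exists>t' s' z'. (t', the (\<theta> s' z')) \<in> germ \<theta> t w \<and> (s', z') \<in> germ \<theta> s z
      \<and> germ \<theta> (t * s) z = germ \<theta> (t' * s') z'"
    using assms mem_germ_self[of s z] mem_germ_self[of t w] by force
qed (use germ_mult_cong assms in blast)

lemma unit_germ_eq_iff:
  "z \<in> topspace Z \<Longrightarrow> w \<in> topspace Z \<Longrightarrow> unit_germ z = unit_germ w \<longleftrightarrow> z = w"
  by (metis base_point_unit_germ)

lemma composableE:
  assumes "(\<gamma>, \<delta>) \<in> composable G"
  obtains t s z w v where "\<theta> s z = Some w" "\<theta> t w = Some v" "\<gamma> = germ \<theta> t w" "\<delta> = germ \<theta> s z"
proof -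
  have "\<gamma> \<in> arrows G" "\<delta> \<in> arrows G" and eq: "Src G \<gamma> = Rng G \<delta>"
    using assms by (auto simp: composable_def)
  then obtain t w' v s z w where 1: "\<theta> t w' = Some v" "\<gamma> = germ \<theta> t w'" "\<theta> s z = Some w" "\<delta> = germ \<theta> s z"
    by (metis arrowE)
  then have "unit_germ w' = unit_germ w"
    using eq by (simp add: Src_germ Rng_germ)
  then have "w' = w"
    using unit_germ_eq_iff act_range 1 by blast
  then show ?thesis
    using that 1 by blast
qed

lemma groupoid_transformation_groupoid: "groupoid G"
proof
  show "Units G \<subseteq> arrows G"
    using unit_germ_in_arrows by (auto simp: Units_transformation_groupoid)
  fix \<gamma> assume \<gamma>: "\<gamma> \<in> arrows G"
  then obtain s z w where s: "\<theta> s z = Some w" and eq: "\<gamma> = germ \<theta> s z"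
    by (rule arrowE)
  note s' = act_star[OF s]
  have zw: "z \<in> topspace Z" "w \<in> topspace Z"
    using act_range[OF s] by auto
  show "Src G \<gamma> \<in> Units G" "Rng G \<gamma> \<in> Units G"
    using s zw by (auto simp: eq Src_germ Rng_germ Units_transformation_groupoid)
  show "Inv G \<gamma> \<in> arrows G"
    unfolding eq Inv_germ[OF s] using germ_in_arrows[OF s'] .
  show "Src G (Inv G \<gamma>) = Rng G \<gamma>" "Rng G (Inv G \<gamma>) = Src G \<gamma>"
    using s s' by (auto simp: eq Src_germ Rng_germ Inv_germ)
  show "Comp G (Inv G \<gamma>) \<gamma> = Src G \<gamma>"
    using s s' by (simp add: eq Inv_germ Src_germ Comp_germ germ_star_mult_eq_unit_germ)
  show "Comp G \<gamma> (Inv G \<gamma>) = Rng G \<gamma>"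
    using s s' by (simp add: eq Inv_germ Rng_germ Comp_germ germ_mult_star_eq_unit_germ)
  show "Comp G \<gamma> (Src G \<gamma>) = \<gamma>"
    using s act_dom_iff[of z s] Comp_germ[of "s\<^sup>\<star> * s" z z s]
    by (simp add: eq Src_germ germ_star_mult_eq_unit_germ act_dom_def star_inverse_left)
  show "Comp G (Rng G \<gamma>) \<gamma> = \<gamma>"
    using s act_dom_range[OF s] Comp_germ[of s z w "s * s\<^sup>\<star>"]
    by (simp add: eq Rng_germ germ_mult_star_eq_unit_germ[OF s] act_dom_def star_inverse)
next
  fix u assume "u \<in> Units G"
  then obtain z where z: "z \<in> topspace Z" "u = unit_germ z"
    by (auto simp: Units_transformation_groupoid)
  obtain e where "\<theta> e z = Some z" "u = germ \<theta> e z"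
    using z by (auto elim: unit_germ_idempotent)
  then show "Src G u = u" "Rng G u = u"
    using z by (simp_all add: Src_germ Rng_germ)
next
  fix \<gamma> \<delta> assume "(\<gamma>, \<delta>) \<in> composable G"
  then obtain t s z w v where s: "\<theta> s z = Some w" and t: "\<theta> t w = Some v"
    and eq: "\<gamma> = germ \<theta> t w" "\<delta> = germ \<theta> s z"
    by (rule composableE)
  have ts: "\<theta> (t * s) z = Some v"
    using s t by (simp add: act_mult)
  have c: "Comp G \<gamma> \<delta> = germ \<theta> (t * s) z"
    using s t by (simp add: eq Comp_germ)
  show "Comp G \<gamma> \<delta> \<in> arrows G"
    unfolding c using germ_in_arrows[OF ts] .
  show "Src G (Comp G \<gamma> \<delta>) = Src G \<delta>"
    unfolding c using s ts by (simp add: eq Src_germ)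
  show "Rng G (Comp G \<gamma> \<delta>) = Rng G \<gamma>"
    unfolding c using t ts by (simp add: eq Rng_germ)
  fix \<kappa> assume k: "(\<delta>, \<kappa>) \<in> composable G"
  then obtain s' z' w' r y v' where r: "\<theta> r y = Some w'" and s': "\<theta> s' w' = Some v'"
    and eq': "\<delta> = germ \<theta> s' w'" "\<kappa> = germ \<theta> r y"
    by (rule composableE)
  have "w' = z"
    using base_point_germ[of s z] base_point_germ[of s' w'] s s' eq(2) eq'(1) by simp
  with r eq' have "\<kappa> = germ \<theta> r y" "\<theta> r y = Some z"
    by auto
  then show "Comp G (Comp G \<gamma> \<delta>) \<kappa> = Comp G \<gamma> (Comp G \<delta> \<kappa>)"
    unfolding c using s t ts by (simp add: eq Comp_germ act_mult mult.assoc)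
qed

section \<open>The topology of the transformation groupoid\<close>

lemma openin_germ_image:
  "openin Z U \<Longrightarrow> U \<subseteq> act_dom \<theta> (s\<^sup>\<star> * s) \<Longrightarrow> openin (Arr G) (germ \<theta> s ` U)"
  unfolding transformation_groupoid_def top_groupoid.simps
  by (rule topology_generated_by_Basis) blast

text \<open>Equality of germs is an open condition: an idempotent that witnesses it at \<open>z\<close> does so on the
  open set \<open>Z\<^sub>e\<close>.\<close>

lemma openin_germ_agree:
  assumes U: "openin Z U" "U \<subseteq> act_dom \<theta> (t\<^sup>\<star> * t)"
  shows "openin Z {z \<in> act_dom \<theta> (s\<^sup>\<star> * s). \<exists>u\<in>U. germ \<theta> s z = germ \<theta> t u}"
proof -
  have "{z \<in> act_dom \<theta> (s\<^sup>\<star> * s). \<exists>u\<in>U. germ \<theta> s z = germ \<theta> t u} =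
      act_dom \<theta> (s\<^sup>\<star> * s) \<inter> U \<inter> (\<Union>e\<in>{e\<in>idempotents. s * e = t * e}. act_dom \<theta> e)" (is "?L = ?R")
  proof (intro set_eqI iffI)
    fix z assume "z \<in> ?L"
    then obtain u where u: "z \<in> act_dom \<theta> (s\<^sup>\<star> * s)" "u \<in> U" "germ \<theta> s z = germ \<theta> t u"
      by blast
    moreover have "\<theta> s z \<noteq> None" "\<theta> t u \<noteq> None"
      using u U(2) act_dom_iff by blast+
    ultimately show "z \<in> ?R"
      using germ_eq_iff[of s z t u] by blast
  next
    fix z assume z: "z \<in> ?R"
    then have "\<theta> s z \<noteq> None" "\<theta> t z \<noteq> None"
      using U(2) act_dom_iff by blast+
    with z show "z \<in> ?L"
      using germ_eq_iff[of s z t z] by blast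
  qed
  moreover have "openin Z ?R"
    using U(1) openin_act_dom star_mult_idempotent(1) by (intro openin_Int openin_Union) auto
  ultimately show ?thesis
    by simp
qed

text \<open>The arrow space carries the final topology of the maps \<open>z \<mapsto> [s,z]\<close>.  The sets on the right form a
  topology containing the generators by the preceding lemma, and each of them is the union over \<open>s\<close> of
  generators.\<close>

lemma openin_Arr_iff:
  "openin (Arr G) W \<longleftrightarrow>
    W \<subseteq> arrows G \<and> (\<forall>s. openin Z {z \<in> act_dom \<theta> (s\<^sup>\<star> * s). germ \<theta> s z \<in> W})"
proof (intro iffI conjI allI)
  assume W: "openin (Arr G) W"
  then show "W \<subseteq> arrows G"
    by (rule openin_subset)
  fix s
  have "generate_topology_on
      {germ \<theta> t ` U | t U. openin Z U \<and> U \<subseteq> act_dom \<theta> (t\<^sup>\<star> * t)} W"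
    using W by (simp add: transformation_groupoid_def openin_topology_generated_by_iff)
  then show "openin Z {z \<in> act_dom \<theta> (s\<^sup>\<star> * s). germ \<theta> s z \<in> W}"
  proof induction
    case (Int A B)
    have "{z \<in> act_dom \<theta> (s\<^sup>\<star> * s). germ \<theta> s z \<in> A \<inter> B} =
      {z \<in> act_dom \<theta> (s\<^sup>\<star> * s). germ \<theta> s z \<in> A} \<inter> {z \<in> act_dom \<theta> (s\<^sup>\<star> * s). germ \<theta> s z \<in> B}"
      by blast
    then show ?case
      using Int by auto
  next
    case (UN K)
    have "{z \<in> act_dom \<theta> (s\<^sup>\<star> * s). germ \<theta> s z \<in> \<Union>K} =
      (\<Union>k\<in>K. {z \<in> act_dom \<theta> (s\<^sup>\<star> * s). germ \<theta> s z \<in> k})"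
      by blast
    then show ?case
      using UN by (auto intro!: openin_Union)
  next
    case (Basis B)
    then obtain t U where "B = germ \<theta> t ` U" "openin Z U" "U \<subseteq> act_dom \<theta> (t\<^sup>\<star> * t)"
      by blast
    then show ?case
      using openin_germ_agree[of U t s] by (simp add: image_iff)
  qed simp
next
  assume W: "W \<subseteq> arrows G \<and> (\<forall>s. openin Z {z \<in> act_dom \<theta> (s\<^sup>\<star> * s). germ \<theta> s z \<in> W})"
  have "W = (\<Union>s. germ \<theta> s ` {z \<in> act_dom \<theta> (s\<^sup>\<star> * s). germ \<theta> s z \<in> W})"
    using W by (fastforce simp: arrows_transformation_groupoid act_dom_iff)
  also have "openin (Arr G) \<dots>"
    using W by (intro openin_Union) (auto intro!: openin_germ_image)
  finally show "openin (Arr G) W" .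
qed

abbreviation germ_domain :: "'s \<Rightarrow> 'z topology"
  where "germ_domain s \<equiv> subtopology Z (act_dom \<theta> (s\<^sup>\<star> * s))"

lemma topspace_germ_domain: "topspace (germ_domain s) = act_dom \<theta> (s\<^sup>\<star> * s)"
  using act_dom_subset by auto

lemma openin_germ_domain: "openin (germ_domain s) U \<longleftrightarrow> openin Z U \<and> U \<subseteq> act_dom \<theta> (s\<^sup>\<star> * s)"
  by (simp add: openin_open_subtopology openin_act_dom star_mult_idempotent(1))

lemma germ_domainE:
  assumes "z \<in> act_dom \<theta> (s\<^sup>\<star> * s)"
  obtains w where "\<theta> s z = Some w"
  using assms by (auto simp: act_dom_iff)

lemma continuous_map_germ: "continuous_map (germ_domain s) (Arr G) (germ \<theta> s)"
  unfolding continuous_map_def topspace_germ_domain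
  by (auto simp: openin_germ_domain openin_Arr_iff elim!: germ_domainE intro: germ_in_arrows)

lemma continuous_map_from_Arr:
  assumes "\<And>s. continuous_map (germ_domain s) Y (\<lambda>z. f (germ \<theta> s z))"
  shows "continuous_map (Arr G) Y f"
  unfolding continuous_map_def
proof (intro conjI allI impI)
  show "f \<in> arrows G \<rightarrow> topspace Y"
    using assms unfolding continuous_map_def topspace_germ_domain
    by (fastforce simp: arrows_transformation_groupoid act_dom_iff)
  fix V assume V: "openin Y V"
  have "{z \<in> act_dom \<theta> (s\<^sup>\<star> * s). germ \<theta> s z \<in> {\<gamma> \<in> arrows G. f \<gamma> \<in> V}} =
      {z \<in> topspace (germ_domain s). f (germ \<theta> s z) \<in> V}" for s
    unfolding topspace_germ_domain by (auto simp: act_dom_iff intro: germ_in_arrows)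
  then show "openin (Arr G) {\<gamma> \<in> arrows G. f \<gamma> \<in> V}"
    using openin_continuous_map_preimage[OF assms V] by (auto simp: openin_Arr_iff openin_germ_domain)
qed

lemma continuous_map_act: "continuous_map (germ_domain s) (germ_domain (s\<^sup>\<star>)) (\<lambda>z. the (\<theta> s z))"
  unfolding continuous_map_in_subtopology topspace_germ_domain
  by (auto simp: continuous_act elim!: germ_domainE dest: act_dom_range)

lemma continuous_map_base_point: "continuous_map (Arr G) Z base_point"
proof (rule continuous_map_from_Arr)
  fix s show "continuous_map (germ_domain s) Z (\<lambda>z. base_point (germ \<theta> s z))"
    by (rule continuous_map_eq[OF continuous_map_from_subtopology[OF continuous_map_id]])
      (auto simp: act_dom_iff base_point_germ)
qed

lemma topspace_unit_space: "topspace (unit_space G) = unit_germ ` topspace Z"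
  using unit_germ_in_arrows by (auto simp: unit_space_def Units_transformation_groupoid)

lemma continuous_map_unit_germ: "continuous_map Z (unit_space G) unit_germ"
proof -
  have "openin Z {z \<in> topspace Z. unit_germ z \<in> W}" if W: "openin (Arr G) W" for W
  proof -
    have "{z \<in> topspace Z. unit_germ z \<in> W} =
        (\<Union>e\<in>idempotents. {z \<in> act_dom \<theta> (e\<^sup>\<star> * e). germ \<theta> e z \<in> W})" (is "?L = ?R")
    proof (intro set_eqI iffI)
      fix z assume "z \<in> ?L"
      then show "z \<in> ?R"
        by (auto elim!: unit_germ_idempotent intro!: bexI simp: star_idempotent idempotent_mult_self)
    next
      fix z assume "z \<in> ?R"
      then show "z \<in> ?L"
        using act_dom_subset
        by (auto simp: star_idempotent idempotent_mult_self germ_idempotent_eq_unit_germ)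
    qed
    moreover have "openin Z ?R"
      using W by (intro openin_Union) (auto simp: openin_Arr_iff)
    ultimately show ?thesis
      by simp
  qed
  then have "continuous_map Z (Arr G) unit_germ"
    unfolding continuous_map_def using unit_germ_in_arrows by auto
  then show ?thesis
    by (auto simp: unit_space_def continuous_map_in_subtopology Units_transformation_groupoid)
qed

lemma homeomorphic_maps_unit_germ: "homeomorphic_maps Z (unit_space G) unit_germ base_point"
  unfolding homeomorphic_maps_def topspace_unit_space
  using continuous_map_unit_germ continuous_map_from_subtopology[OF continuous_map_base_point]
  by (auto simp: base_point_unit_germ unit_space_def)

lemma homeomorphic_map_unit_germ: "homeomorphic_map Z (unit_space G) unit_germ"
  using homeomorphic_maps_unit_germ homeomorphic_map_maps by blast

lemma continuous_map_Src: "continuous_map (Arr G) (unit_space G) (Src G)"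
proof (rule continuous_map_from_Arr)
  fix s show "continuous_map (germ_domain s) (unit_space G) (\<lambda>z. Src G (germ \<theta> s z))"
    by (rule continuous_map_eq[OF continuous_map_from_subtopology[OF continuous_map_unit_germ]])
      (auto simp: act_dom_iff Src_germ)
qed

lemma continuous_map_Rng: "continuous_map (Arr G) (unit_space G) (Rng G)"
proof (rule continuous_map_from_Arr)
  fix s show "continuous_map (germ_domain s) (unit_space G) (\<lambda>z. Rng G (germ \<theta> s z))"
    by (rule continuous_map_eq[OF continuous_map_compose[OF continuous_act continuous_map_unit_germ]])
      (auto simp: act_dom_iff Rng_germ)
qed

lemma continuous_map_Inv: "continuous_map (Arr G) (Arr G) (Inv G)"
proof (rule continuous_map_from_Arr)
  fix s show "continuous_map (germ_domain s) (Arr G) (\<lambda>z. Inv G (germ \<theta> s z))"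
    by (rule continuous_map_eq[OF continuous_map_compose[OF continuous_map_act continuous_map_germ]])
      (auto simp: act_dom_iff Inv_germ)
qed

text \<open>Composable pairs are covered by the open sets of pairs \<open>([t,w],[s,z])\<close> with \<open>t\<close> and \<open>s\<close> fixed, on
  which multiplication is \<open>[ts, -]\<close> applied to the base point of the second factor.\<close>

lemma continuous_map_Comp:
  "continuous_map (subtopology (prod_topology (Arr G) (Arr G)) (composable G)) (Arr G)
    (\<lambda>(g, h). Comp G g h)"
proof -
  define B where "B s = germ \<theta> s ` act_dom \<theta> (s\<^sup>\<star> * s)" for s
  define T where "T = (\<lambda>(t, s). composable G \<inter> B t \<times> B s)"
  have B: "openin (Arr G) (B s)" for s
    unfolding B_def using openin_act_dom star_mult_idempotent(1) by (intro openin_germ_image) auto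
  have T: "\<exists>z w v. \<theta> s z = Some w \<and> \<theta> t w = Some v \<and> x = (germ \<theta> t w, germ \<theta> s z)"
    if x: "x \<in> T (t, s)" for x t s
  proof -
    obtain w' z where x: "x = (germ \<theta> t w', germ \<theta> s z)" "x \<in> composable G"
        "\<theta> t w' \<noteq> None" "\<theta> s z \<noteq> None"
      using x by (auto simp: T_def B_def act_dom_iff)
    then obtain w where w: "\<theta> s z = Some w"
      by blast
    then have "unit_germ w' = unit_germ w"
      using x by (auto simp: composable_def Src_germ Rng_germ)
    then have "w' = w"
      using w x(3) act_range unit_germ_eq_iff by blast
    with w x show ?thesis
      by auto
  qed
  have comp: "(\<lambda>(g, h). Comp G g h) x = germ \<theta> (t * s) (base_point (snd x))"
    and dom: "base_point (snd x) \<in> act_dom \<theta> ((t * s)\<^sup>\<star> * (t * s))"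
    if "x \<in> T (t, s)" for x t s
    using T[OF that] by (auto simp: Comp_germ base_point_germ act_dom_iff act_mult)
  let ?P = "subtopology (prod_topology (Arr G) (Arr G)) (composable G)"
  show ?thesis
  proof (rule pasting_lemma[where I = UNIV and T = T
        and f = "\<lambda>(t, s) x. germ \<theta> (t * s) (base_point (snd x))"])
    fix i :: "'s \<times> 's"
    obtain t s where i: "i = (t, s)"
      by fastforce
    show "openin ?P (T i)"
      unfolding i T_def
      by (auto simp: openin_subtopology_Int2 openin_prod_Times_iff B)
    have "continuous_map (subtopology ?P (T i)) (germ_domain (t * s)) (\<lambda>x. base_point (snd x))"
      unfolding continuous_map_in_subtopology
      using continuous_map_compose[OF continuous_map_snd continuous_map_base_point, of "Arr G"] dom
      by (auto simp: i o_def intro!: continuous_map_from_subtopology)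
    from continuous_map_compose[OF this continuous_map_germ]
    show "continuous_map (subtopology ?P (T i)) (Arr G)
        ((\<lambda>(t, s) x. germ \<theta> (t * s) (base_point (snd x))) i)"
      by (simp add: i o_def)
  next
    fix i j :: "'s \<times> 's" and x
    obtain t s t' s' where ij: "i = (t, s)" "j = (t', s')"
      by (cases i; cases j)
    assume "x \<in> topspace ?P \<inter> T i \<inter> T j"
    then show "(\<lambda>(t, s) x. germ \<theta> (t * s) (base_point (snd x))) i x =
        (\<lambda>(t, s) x. germ \<theta> (t * s) (base_point (snd x))) j x"
      using comp[of x t s] comp[of x t' s'] by (simp add: ij)
  next
    fix x assume "x \<in> topspace ?P"
    then have "x \<in> composable G"
      by simp
    then obtain t s z w v where "\<theta> s z = Some w" "\<theta> t w = Some v" "x = (germ \<theta> t w, germ \<theta> s z)"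
      by (metis composableE prod.collapse)
    then have "x \<in> T (t, s)"
      using \<open>x \<in> composable G\<close> by (auto simp: T_def B_def act_dom_iff)
    then show "\<exists>j. j \<in> UNIV \<and> x \<in> T j \<and> (\<lambda>(g, h). Comp G g h) x =
        (\<lambda>(t, s) x. germ \<theta> (t * s) (base_point (snd x))) j x"
      using comp[of x t s] by auto
  qed
qed

text \<open>Source and range both have the form \<open>[s,z] \<mapsto> [e, \<phi> z]\<close> on the bisection of all \<open>[s,z]\<close>, where \<open>\<phi>\<close> is a
  homeomorphism with inverse \<open>h s\<close>, defined on the open set \<open>V s\<close>: the identity for the source and
  \<open>\<theta>\<^sub>s\<close> for the range.\<close>

lemma local_homeomorphism_from_Arr:
  assumes f: "continuous_map (Arr G) (unit_space G) f"
    and V: "\<And>s. openin Z (V s)"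
    and h: "\<And>s. continuous_map (subtopology Z (V s)) (germ_domain s) (h s)"
    and fh: "\<And>s w. w \<in> V s \<Longrightarrow> f (germ \<theta> s (h s w)) = unit_germ w"
    and hf: "\<And>s z. z \<in> act_dom \<theta> (s\<^sup>\<star> * s) \<Longrightarrow> \<exists>w\<in>V s. f (germ \<theta> s z) = unit_germ w \<and> h s w = z"
  shows "local_homeomorphism (Arr G) (unit_space G) f"
  unfolding local_homeomorphism_def
proof
  fix \<gamma> assume "\<gamma> \<in> arrows G"
  then obtain s z w where s: "\<theta> s z = Some w" "\<gamma> = germ \<theta> s z"
    by (rule arrowE)
  define U where "U = germ \<theta> s ` act_dom \<theta> (s\<^sup>\<star> * s)"
  have U: "openin (Arr G) U"
    unfolding U_def using openin_act_dom star_mult_idempotent(1) by (intro openin_germ_image) auto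
  have VZ: "V s \<subseteq> topspace Z"
    using V openin_subset by blast
  have hV: "h s w \<in> act_dom \<theta> (s\<^sup>\<star> * s)" if "w \<in> V s" for w
    using h[of s] that VZ unfolding continuous_map_in_subtopology by auto
  have fU: "f ` U = unit_germ ` V s"
  proof
    show "f ` U \<subseteq> unit_germ ` V s"
      unfolding U_def using hf by blast
    show "unit_germ ` V s \<subseteq> f ` U"
      unfolding U_def using hV fh by (force simp: image_iff)
  qed
  have "openin (unit_space G) (f ` U)"
    unfolding fU using homeomorphic_map_openness[OF homeomorphic_map_unit_germ] V VZ by blast
  moreover have "homeomorphic_maps (subtopology (Arr G) U) (subtopology (unit_space G) (f ` U))
      f (\<lambda>u. germ \<theta> s (h s (base_point u)))"
    unfolding homeomorphic_maps_def
  proof (intro conjI ballI)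
    show "continuous_map (subtopology (Arr G) U) (subtopology (unit_space G) (f ` U)) f"
      using f by (auto simp: continuous_map_in_subtopology continuous_map_from_subtopology)
    have base: "continuous_map (subtopology (unit_space G) (f ` U)) (subtopology Z (V s)) base_point"
      using homeomorphic_maps_unit_germ VZ unfolding homeomorphic_maps_def fU
      by (auto simp: continuous_map_in_subtopology continuous_map_from_subtopology base_point_unit_germ subset_iff)
    have "continuous_map (subtopology (unit_space G) (f ` U)) (Arr G)
        (\<lambda>u. germ \<theta> s (h s (base_point u)))"
      using continuous_map_compose[OF continuous_map_compose[OF base h] continuous_map_germ]
      by (simp add: o_def)
    then show "continuous_map (subtopology (unit_space G) (f ` U)) (subtopology (Arr G) U)
        (\<lambda>u. germ \<theta> s (h s (base_point u)))"
      unfolding continuous_map_in_subtopology fU using VZ hV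
      by (auto simp: U_def base_point_unit_germ subset_iff)
  next
    fix \<delta> assume "\<delta> \<in> topspace (subtopology (Arr G) U)"
    then obtain z where z: "z \<in> act_dom \<theta> (s\<^sup>\<star> * s)" "\<delta> = germ \<theta> s z"
      by (auto simp: U_def)
    then show "germ \<theta> s (h s (base_point (f \<delta>))) = \<delta>"
      using hf[OF z(1)] VZ by (auto simp: base_point_unit_germ subset_iff)
  next
    fix u assume "u \<in> topspace (subtopology (unit_space G) (f ` U))"
    then show "f (germ \<theta> s (h s (base_point u))) = u"
      using VZ by (auto simp: fU base_point_unit_germ subset_iff fh)
  qed
  moreover have "\<gamma> \<in> U"
    using s by (auto simp: U_def act_dom_iff)
  ultimately show "\<exists>U. openin (Arr G) U \<and> \<gamma> \<in> U \<and> openin (unit_space G) (f ` U) \<and>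
      homeomorphic_map (subtopology (Arr G) U) (subtopology (unit_space G) (f ` U)) f"
    using U homeomorphic_map_maps by blast
qed

lemma local_homeomorphism_Src: "local_homeomorphism (Arr G) (unit_space G) (Src G)"
  by (rule local_homeomorphism_from_Arr[where V = "\<lambda>s. act_dom \<theta> (s\<^sup>\<star> * s)" and h = "\<lambda>s z. z"])
    (auto simp: continuous_map_Src openin_act_dom star_mult_idempotent(1) act_dom_iff Src_germ)

lemma local_homeomorphism_Rng: "local_homeomorphism (Arr G) (unit_space G) (Rng G)"
proof (rule local_homeomorphism_from_Arr[where V = "\<lambda>s. act_dom \<theta> (s * s\<^sup>\<star>)"
      and h = "\<lambda>s w. the (\<theta> (s\<^sup>\<star>) w)"])
  fix s
  show "continuous_map (subtopology Z (act_dom \<theta> (s * s\<^sup>\<star>))) (germ_domain s) (\<lambda>w. the (\<theta> (s\<^sup>\<star>) w))"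
    using continuous_map_act[of "s\<^sup>\<star>"] by simp
  show "Rng G (germ \<theta> s (the (\<theta> (s\<^sup>\<star>) w))) = unit_germ w" if w: "w \<in> act_dom \<theta> (s * s\<^sup>\<star>)" for w
  proof -
    obtain z where "\<theta> (s\<^sup>\<star>) w = Some z"
      using w act_dom_iff[of w "s\<^sup>\<star>"] by auto
    then show ?thesis
      using act_star_iff[of s w z] by (simp add: Rng_germ)
  qed
  show "\<exists>w\<in>act_dom \<theta> (s * s\<^sup>\<star>). Rng G (germ \<theta> s z) = unit_germ w \<and> the (\<theta> (s\<^sup>\<star>) w) = z"
    if z: "z \<in> act_dom \<theta> (s\<^sup>\<star> * s)" for z
  proof -
    obtain w where "\<theta> s z = Some w"
      using z by (rule germ_domainE)
    then show ?thesis
      using act_dom_range by (intro bexI[of _ w]) (auto simp: Rng_germ act_star)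
  qed
qed (auto simp: continuous_map_Rng openin_act_dom star_mult_idempotent)

theorem etale_groupoid_transformation_groupoid:
  assumes "locally_compact_space Z" "Hausdorff_space Z"
  shows "etale_groupoid G"
proof -
  interpret groupoid G
    by (rule groupoid_transformation_groupoid)
  have "Z homeomorphic_space unit_space G"
    using homeomorphic_maps_unit_germ unfolding homeomorphic_space_def by blast
  then show ?thesis
    using assms homeomorphic_locally_compact_space homeomorphic_Hausdorff_space
    by unfold_locales (auto simp: continuous_map_Comp continuous_map_Inv local_homeomorphism_Src
        local_homeomorphism_Rng)
qed

lemma totally_disconnected_unit_space_iff:
  "totally_disconnected_space (unit_space G) \<longleftrightarrow> totally_disconnected_space Z"
proof
  show "totally_disconnected_space (unit_space G) \<Longrightarrow> totally_disconnected_space Z"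
    using totally_disconnected_space_inj_preimage[OF continuous_map_unit_germ]
    by (simp add: inj_on_def unit_germ_eq_iff)
  have "inj_on base_point (topspace (unit_space G))" "continuous_map (unit_space G) Z base_point"
    using homeomorphic_maps_unit_germ unfolding homeomorphic_maps_def by (metis inj_onI)+
  then show "totally_disconnected_space Z \<Longrightarrow> totally_disconnected_space (unit_space G)"
    using totally_disconnected_space_inj_preimage by blast
qed

end

corollary ample_transformation_groupoid_iff:
  assumes "inverse_semigroup_action Z \<theta>" "locally_compact_space Z" "Hausdorff_space Z"
  shows "ample_groupoid (transformation_groupoid Z \<theta>) \<longleftrightarrow> totally_disconnected_space Z"
proof -
  interpret action Z \<theta>
    using assms(1) by unfold_locales
  show ?thesis
    using etale_groupoid_transformation_groupoid[OF assms(2,3)] totally_disconnected_unit_space_iff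
    by (auto simp: ample_groupoid_def ample_groupoid_axioms_def)
qed

section \<open>Points of \<open>X\<^sup>K\<^sup>S\<close>\<close>

locale lch_action = action X \<theta>
  for X :: "'x topology" and \<theta> :: "'s::inverse_semigroup \<Rightarrow> 'x \<rightharpoonup> 'x" +
  assumes locally_compact: "locally_compact_space X"
    and Hausdorff: "Hausdorff_space X"
begin

abbreviation compactified :: "'s \<Rightarrow> 'x option topology"
  where "compactified e \<equiv> Alexandroff_compactification (subtopology X (act_dom \<theta> e))"

lemma KS_product_iff:
  "\<tau> \<in> topspace (KS_product X \<theta>) \<longleftrightarrow>
    \<tau> \<in> extensional idempotents \<and> (\<forall>e\<in>idempotents. \<forall>x. \<tau> e = Some x \<longrightarrow> x \<in> act_dom \<theta> e)"
proof -
  have "\<tau> e \<in> topspace (compactified e) \<longleftrightarrow> (\<forall>x. \<tau> e = Some x \<longrightarrow> x \<in> act_dom \<theta> e)" for e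
    using act_dom_subset[of e] by (cases "\<tau> e") auto
  then show ?thesis
    by (auto simp: KS_product_def PiE_def Pi_def)
qed

text \<open>The order condition follows from the two symmetric conditions used here: finiteness is
  multiplicative, and all finite coordinates have one common value.\<close>

lemma KS_tildeI:
  assumes ext: "\<tau> \<in> extensional idempotents"
    and dom: "\<And>e x. e \<in> idempotents \<Longrightarrow> \<tau> e = Some x \<Longrightarrow> x \<in> act_dom \<theta> e"
    and mult: "\<And>e f. e \<in> idempotents \<Longrightarrow> f \<in> idempotents \<Longrightarrow>
      \<tau> (e * f) \<noteq> None \<longleftrightarrow> \<tau> e \<noteq> None \<and> \<tau> f \<noteq> None"
    and val: "\<And>e f x y. e \<in> idempotents \<Longrightarrow> f \<in> idempotents \<Longrightarrow> \<tau> e = Some x \<Longrightarrow> \<tau> f = Some y \<Longrightarrow> x = y"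
  shows "\<tau> \<in> KS_tilde X \<theta>"
proof -
  have "\<tau> e2 = \<tau> e1" if "e1 \<in> idempotents" "e2 \<in> idempotents" "e1 \<preceq> e2" "\<tau> e1 \<noteq> None" for e1 e2
  proof -
    have "e2 * e1 = e1"
      using that natural_le_idempotent by blast
    then have "\<tau> e2 \<noteq> None"
      using mult[of e2 e1] that by simp
    with that(4) show ?thesis
      using val[OF that(1,2)] that(4) by fastforce
  qed
  moreover have "\<tau> \<in> topspace (KS_product X \<theta>)"
    using ext dom by (simp add: KS_product_iff)
  ultimately show ?thesis
    unfolding KS_tilde_def using mult by blast
qed

lemma KS_tildeD:
  assumes "\<tau> \<in> KS_tilde X \<theta>"
  shows "\<tau> \<in> topspace (KS_product X \<theta>)"
    and "e \<in> idempotents \<Longrightarrow> f \<in> idempotents \<Longrightarrow> e \<preceq> f \<Longrightarrow> \<tau> e \<noteq> None \<Longrightarrow> \<tau> f = \<tau> e"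
    and "e \<in> idempotents \<Longrightarrow> f \<in> idempotents \<Longrightarrow> \<tau> e \<noteq> None \<Longrightarrow> \<tau> f \<noteq> None \<Longrightarrow> \<tau> (e * f) \<noteq> None"
  using assms unfolding KS_tilde_def by blast+

lemma KS_tilde_extensional: "\<tau> \<in> KS_tilde X \<theta> \<Longrightarrow> \<tau> \<in> extensional idempotents"
  using KS_tildeD(1) KS_product_iff by blast

lemma KS_tilde_dom: "\<tau> \<in> KS_tilde X \<theta> \<Longrightarrow> e \<in> idempotents \<Longrightarrow> \<tau> e = Some x \<Longrightarrow> x \<in> act_dom \<theta> e"
  using KS_tildeD(1) KS_product_iff by blast

lemma KS_tilde_mono:
  assumes "\<tau> \<in> KS_tilde X \<theta>" "e \<in> idempotents" "f \<in> idempotents" "f * e = e" "\<tau> e = Some x"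
  shows "\<tau> f = Some x"
proof -
  have "\<tau> f = \<tau> e"
    using KS_tildeD(2)[OF assms(1-3)] assms(4,5) natural_le_idempotent[OF assms(2)] by simp
  with assms show ?thesis
    by simp
qed

lemma KS_tilde_mult_iff:
  assumes \<tau>: "\<tau> \<in> KS_tilde X \<theta>" and e: "e \<in> idempotents" and f: "f \<in> idempotents"
  shows "\<tau> (e * f) = Some x \<longleftrightarrow> \<tau> e = Some x \<and> \<tau> f = Some x"
proof -
  note ef = idempotent_mult[OF e f]
  have le: "e * (e * f) = e * f" "f * (e * f) = e * f"
    using idempotent_mult_cancel[OF e, of f] idempotent_mult_cancel[OF f, of e]
      idempotent_commute[OF e f] by auto
  note down = KS_tilde_mono[OF \<tau> ef e le(1)] KS_tilde_mono[OF \<tau> ef f le(2)]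
  have "\<tau> (e * f) \<noteq> None" if "\<tau> e = Some x" "\<tau> f = Some x"
    using KS_tildeD(3)[OF \<tau> e f] that by simp
  then show ?thesis
    using down by (cases "\<tau> (e * f)") auto
qed

lemma KS_tilde_value_unique:
  assumes \<tau>: "\<tau> \<in> KS_tilde X \<theta>" and e: "e \<in> idempotents" and f: "f \<in> idempotents"
    and "\<tau> e = Some x" "\<tau> f = Some y"
  shows "x = y"
proof -
  have "\<tau> (e * f) \<noteq> None"
    using KS_tildeD(3)[OF \<tau> e f] assms by simp
  then show ?thesis
    using KS_tilde_mult_iff[OF \<tau> e f] assms by auto
qed

lemma topspace_KS_space: "topspace (KS_space X \<theta>) = KS_tilde X \<theta> - {KS_infinity}"
  unfolding KS_space_def using KS_tildeD(1) by auto

lemma KS_space_iff: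
  "\<tau> \<in> topspace (KS_space X \<theta>) \<longleftrightarrow> \<tau> \<in> KS_tilde X \<theta> \<and> (\<exists>e\<in>idempotents. \<tau> e \<noteq> None)"
proof -
  have "\<tau> = KS_infinity \<longleftrightarrow> (\<forall>e\<in>idempotents. \<tau> e = None)" if "\<tau> \<in> KS_tilde X \<theta>"
    using KS_tilde_extensional[OF that] by (auto simp: KS_infinity_def extensional_def fun_eq_iff)
  then show ?thesis
    by (auto simp: topspace_KS_space)
qed

section \<open>\<open>X\<^sup>K\<^sup>S\<close> is locally compact Hausdorff\<close>

lemma compact_neighbourhood:
  assumes "openin X W" "x \<in> W"
  obtains U L where "openin X U" "compactin X L" "x \<in> U" "U \<subseteq> L" "L \<subseteq> W"
  using locally_compact assms
  unfolding locally_compact_space_neighbourhood_base[OF disjI1[OF Hausdorff]] neighbourhood_base_of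
  by meson

lemma openin_compactified_Some:
  "openin X U \<Longrightarrow> U \<subseteq> act_dom \<theta> e \<Longrightarrow> openin (compactified e) (Some ` U)"
  by (simp add: subset_openin_subtopology)

lemma closedin_compactified_Some:
  "compactin X L \<Longrightarrow> L \<subseteq> act_dom \<theta> e \<Longrightarrow> closedin (compactified e) (Some ` L)"
  by (simp add: compactin_subtopology compactin_imp_closedin Hausdorff_space_subtopology Hausdorff)

lemma continuous_map_coordinate:
  "e \<in> idempotents \<Longrightarrow> continuous_map (KS_product X \<theta>) (compactified e) (\<lambda>\<tau>. \<tau> e)"
  unfolding KS_product_def by (rule continuous_map_product_projection)

lemma openin_KS_product_Some:
  assumes "e \<in> idempotents" "openin X U" "U \<subseteq> act_dom \<theta> e"
  shows "openin (KS_product X \<theta>) {\<tau> \<in> topspace (KS_product X \<theta>). \<tau> e \<in> Some ` U}"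
  using openin_continuous_map_preimage[OF continuous_map_coordinate] openin_compactified_Some assms
  by blast

lemma closedin_KS_product_Some:
  assumes "e \<in> idempotents" "compactin X L" "L \<subseteq> act_dom \<theta> e"
  shows "closedin (KS_product X \<theta>) {\<tau> \<in> topspace (KS_product X \<theta>). \<tau> e \<in> Some ` L}"
  using closedin_continuous_map_preimage[OF continuous_map_coordinate] closedin_compactified_Some assms
  by blast

lemma openin_KS_space_Some:
  assumes "e \<in> idempotents" "openin X U" "U \<subseteq> act_dom \<theta> e"
  shows "openin (KS_space X \<theta>) {\<tau> \<in> topspace (KS_space X \<theta>). \<tau> e \<in> Some ` U}"
proof -
  have "{\<tau> \<in> topspace (KS_space X \<theta>). \<tau> e \<in> Some ` U} =
      {\<tau> \<in> topspace (KS_product X \<theta>). \<tau> e \<in> Some ` U} \<inter> (KS_tilde X \<theta> - {KS_infinity})"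
    by (auto simp: KS_space_def)
  then show ?thesis
    using openin_KS_product_Some[OF assms] by (auto simp: KS_space_def openin_subtopology)
qed

lemma closedin_KS_space_Some:
  assumes "e \<in> idempotents" "compactin X L" "L \<subseteq> act_dom \<theta> e"
  shows "closedin (KS_space X \<theta>) {\<tau> \<in> topspace (KS_space X \<theta>). \<tau> e \<in> Some ` L}"
proof -
  have "{\<tau> \<in> topspace (KS_space X \<theta>). \<tau> e \<in> Some ` L} =
      {\<tau> \<in> topspace (KS_product X \<theta>). \<tau> e \<in> Some ` L} \<inter> (KS_tilde X \<theta> - {KS_infinity})"
    by (auto simp: KS_space_def)
  then show ?thesis
    using closedin_KS_product_Some[OF assms] by (auto simp: KS_space_def closedin_subtopology)
qed

lemma Hausdorff_KS_product: "Hausdorff_space (KS_product X \<theta>)"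
  unfolding KS_product_def Hausdorff_space_product_topology Hausdorff_space_Alexandroff_compactification
  using locally_compact_space_open_subset[OF disjI1[OF Hausdorff] locally_compact openin_act_dom]
    Hausdorff_space_subtopology[OF Hausdorff] by blast

text \<open>A violation of either condition persists nearby.  If \<open>e \<le> f\<close> and \<open>\<tau>(f) \<noteq> \<tau>(e) = x\<close>, take a compact
  neighbourhood \<open>L \<subseteq> X\<^sub>e\<close> of \<open>x\<close> that avoids \<open>\<tau>(f)\<close>: nearby points have \<open>e\<close>-coordinate in \<open>L\<close> and
  \<open>f\<close>-coordinate outside.  If \<open>\<tau>(e)\<close> and \<open>\<tau>(f)\<close> are finite and \<open>\<tau>(ef)\<close> is not, take compact
  neighbourhoods \<open>K \<subseteq> X\<^sub>e\<close> and \<open>L \<subseteq> X\<^sub>f\<close> of the two values: for a nearby point of the closed set the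
  common value would lie in \<open>K \<inter> L\<close>, while its \<open>ef\<close>-coordinate avoids the compact set \<open>K \<inter> L \<subseteq> X\<^bsub>ef\<^esub>\<close>.\<close>

lemma closedin_KS_tilde: "closedin (KS_product X \<theta>) (KS_tilde X \<theta>)"
  unfolding closedin_def
proof
  let ?P = "KS_product X \<theta>"
  show "KS_tilde X \<theta> \<subseteq> topspace ?P"
    using KS_tildeD(1) by blast
  show "openin ?P (topspace ?P - KS_tilde X \<theta>)"
  proof (subst openin_subopen, intro ballI)
    fix \<tau> assume \<tau>: "\<tau> \<in> topspace ?P - KS_tilde X \<theta>"
    then have \<tau>P: "\<tau> \<in> topspace ?P"
      by blast
    have dom: "x \<in> act_dom \<theta> e" if "e \<in> idempotents" "\<tau> e = Some x" for e x
      using \<tau>P that by (auto simp: KS_product_iff)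
    consider (mono) e f where "e \<in> idempotents" "f \<in> idempotents" "f * e = e" "\<tau> e \<noteq> None" "\<tau> f \<noteq> \<tau> e"
      | (mult) e f where "e \<in> idempotents" "f \<in> idempotents" "\<tau> e \<noteq> None" "\<tau> f \<noteq> None" "\<tau> (e * f) = None"
      using \<tau> unfolding KS_tilde_def mem_Collect_eq Diff_iff by (metis natural_le_idempotent)
    then show "\<exists>T. openin ?P T \<and> \<tau> \<in> T \<and> T \<subseteq> topspace ?P - KS_tilde X \<theta>"
    proof cases
      case mono
      then obtain x where x: "\<tau> e = Some x"
        by blast
      have sub: "act_dom \<theta> e \<subseteq> act_dom \<theta> f"
        using act_dom_mult[OF mono(2,1)] mono(3) by auto
      (* The set of y with \<tau> f = Some y is empty or a point; this treats both cases at once. *)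
      have "finite {y. \<tau> f = Some y}"
        by (cases "\<tau> f") auto
      then have "closedin X (topspace X \<inter> {y. \<tau> f = Some y})"
        by (intro closedin_Hausdorff_finite[OF Hausdorff]) auto
      then have "openin X (act_dom \<theta> e - (topspace X \<inter> {y. \<tau> f = Some y}))"
        using openin_act_dom mono(1) by blast
      moreover have "x \<in> act_dom \<theta> e - (topspace X \<inter> {y. \<tau> f = Some y})"
        using mono(5) x dom[OF mono(1) x] by auto
      ultimately obtain U L where UL: "openin X U" "compactin X L" "x \<in> U" "U \<subseteq> L"
          "L \<subseteq> act_dom \<theta> e - (topspace X \<inter> {y. \<tau> f = Some y})"
        by (rule compact_neighbourhood)
      (* L is compact in the larger set X_f too, hence closed in its compactification. *)
      define T where "T = {\<sigma> \<in> topspace ?P. \<sigma> e \<in> Some ` U} - {\<sigma> \<in> topspace ?P. \<sigma> f \<in> Some ` L}"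
      have "openin ?P T"
        unfolding T_def using UL sub mono
        by (intro openin_diff openin_KS_product_Some closedin_KS_product_Some) auto
      moreover have "\<tau> \<in> T"
        using UL x \<tau>P act_dom_subset[of e] by (auto simp: T_def)
      moreover have "\<sigma> \<notin> KS_tilde X \<theta>" if "\<sigma> \<in> T" for \<sigma>
        using that KS_tilde_mono[OF _ mono(1-3), of \<sigma>] UL(4) by (auto simp: T_def)
      ultimately show ?thesis
        by (auto simp: T_def)
    next
      case mult
      then obtain x y where xy: "\<tau> e = Some x" "\<tau> f = Some y"
        by blast
      obtain U K where UK: "openin X U" "compactin X K" "x \<in> U" "U \<subseteq> K" "K \<subseteq> act_dom \<theta> e"
        using compact_neighbourhood[OF openin_act_dom[OF mult(1)] dom[OF mult(1) xy(1)]] .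
      obtain V L where VL: "openin X V" "compactin X L" "y \<in> V" "V \<subseteq> L" "L \<subseteq> act_dom \<theta> f"
        using compact_neighbourhood[OF openin_act_dom[OF mult(2)] dom[OF mult(2) xy(2)]] .
      have KL: "compactin X (K \<inter> L)"
        using UK VL compactin_imp_closedin[OF Hausdorff] by (simp add: closed_Int_compactin)
      define T where "T = {\<sigma> \<in> topspace ?P. \<sigma> e \<in> Some ` U} \<inter> {\<sigma> \<in> topspace ?P. \<sigma> f \<in> Some ` V}
        - {\<sigma> \<in> topspace ?P. \<sigma> (e * f) \<in> Some ` (K \<inter> L)}"
      have "openin ?P T"
        unfolding T_def
      proof (intro openin_diff openin_Int openin_KS_product_Some closedin_KS_product_Some KL)
        show "K \<inter> L \<subseteq> act_dom \<theta> (e * f)"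
          using UK VL act_dom_mult mult by auto
      qed (use UK VL mult idempotent_mult in auto)
      moreover have "\<tau> \<in> T"
        using UK VL xy \<tau>P mult(5) by (auto simp: T_def)
      moreover have "\<sigma> \<notin> KS_tilde X \<theta>" if \<sigma>T: "\<sigma> \<in> T" for \<sigma>
      proof
        assume \<sigma>: "\<sigma> \<in> KS_tilde X \<theta>"
        obtain u v where uv: "\<sigma> e = Some u" "u \<in> U" "\<sigma> f = Some v" "v \<in> V"
          using \<sigma>T by (auto simp: T_def)
        then have "u = v"
          using KS_tilde_value_unique[OF \<sigma> mult(1,2)] by blast
        then show False
          using \<sigma>T uv KS_tilde_mult_iff[OF \<sigma> mult(1,2), of u] UK VL by (auto simp: T_def)
      qed
      ultimately show ?thesis
        by (auto simp: T_def)
    qed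
  qed
qed

lemma Hausdorff_KS_space: "Hausdorff_space (KS_space X \<theta>)"
  unfolding KS_space_def by (rule Hausdorff_space_subtopology[OF Hausdorff_KS_product])

text \<open>The remaining points are those with some finite coordinate, an open condition in the compact
  Hausdorff space \<open>KS_tilde X \<theta>\<close>.\<close>

lemma locally_compact_KS_space: "locally_compact_space (KS_space X \<theta>)"
proof -
  let ?P = "KS_product X \<theta>"
  let ?T = "subtopology ?P (KS_tilde X \<theta>)"
  have "compact_space ?P"
    by (simp add: KS_product_def compact_space_product_topology)
  then have "compact_space ?T"
    using closedin_KS_tilde closedin_compact_space compact_space_subtopology by blast
  have eq: "KS_tilde X \<theta> - {KS_infinity} = (\<Union>e\<in>idempotents. {\<tau> \<in> topspace ?P. \<tau> e \<in> Some ` act_dom \<theta> e}) \<inter> KS_tilde X \<theta>"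
    (is "?L = ?R")
  proof -
    have "\<tau> \<in> ?L \<longleftrightarrow> \<tau> \<in> ?R" for \<tau>
      using KS_space_iff[of \<tau>] KS_tilde_dom[of \<tau>] closedin_subset[OF closedin_KS_tilde]
      unfolding topspace_KS_space by auto
    then show ?thesis
      by blast
  qed
  have "openin ?P (\<Union>e\<in>idempotents. {\<tau> \<in> topspace ?P. \<tau> e \<in> Some ` act_dom \<theta> e})"
    using openin_act_dom openin_KS_product_Some by (intro openin_Union) auto
  then have "openin ?T (KS_tilde X \<theta> - {KS_infinity})"
    unfolding openin_subtopology eq by blast
  moreover have "Hausdorff_space ?T" "locally_compact_space ?T"
    using Hausdorff_space_subtopology[OF Hausdorff_KS_product]
      compact_imp_locally_compact_space[OF \<open>compact_space ?T\<close>] by auto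
  ultimately have "locally_compact_space (subtopology ?T (KS_tilde X \<theta> - {KS_infinity}))"
    using locally_compact_space_open_subset by blast
  moreover have "KS_tilde X \<theta> \<inter> (KS_tilde X \<theta> - {KS_infinity}) = KS_tilde X \<theta> - {KS_infinity}"
    by blast
  ultimately show ?thesis
    by (simp add: KS_space_def subtopology_subtopology)
qed

section \<open>The action on \<open>X\<^sup>K\<^sup>S\<close>\<close>

lemma KS_tilde_conjugate_le:
  assumes \<tau>: "\<tau> \<in> KS_tilde X \<theta>" and e: "e \<in> idempotents" and "\<tau> (s\<^sup>\<star> * e * s) = Some x"
  shows "\<tau> (s\<^sup>\<star> * s) = Some x"
proof (rule KS_tilde_mono[OF \<tau> conjugate_idempotent[OF e] star_mult_idempotent(1) _ assms(3)])
  show "s\<^sup>\<star> * s * (s\<^sup>\<star> * e * s) = s\<^sup>\<star> * e * s"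
    by (simp add: mult.assoc star_cancel)
qed

lemma KS_tilde_act_defined:
  assumes "\<tau> \<in> KS_tilde X \<theta>" "\<tau> (s\<^sup>\<star> * s) = Some x"
  obtains y where "\<theta> s x = Some y"
  using KS_tilde_dom[OF assms(1) star_mult_idempotent(1) assms(2)] act_dom_iff by blast

text \<open>If \<open>x\<close> is the common value of the finite coordinates of \<open>\<tau>\<close> and \<open>y = \<theta>\<^sub>s x\<close>, then \<open>\<theta>\<^bsub>es\<^esub> x = y\<close> whenever it
  is defined.  So \<open>s\<close> changes the common value to \<open>y\<close> and pulls back the set of finite coordinates
  along \<open>e \<mapsto> s\<^sup>\<star> e s\<close>; in this form the action is easy to compose.\<close>

definition transported :: "'s \<Rightarrow> 'x \<Rightarrow> ('s \<Rightarrow> 'x option) \<Rightarrow> 's \<Rightarrow> 'x option"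
  where "transported s y \<tau> = (\<lambda>e\<in>idempotents. if \<tau> (s\<^sup>\<star> * e * s) = None then None else Some y)"

lemma transported_eq: "e \<in> idempotents \<Longrightarrow>
    transported s y \<tau> e = (if \<tau> (s\<^sup>\<star> * e * s) = None then None else Some y)"
  by (simp add: transported_def)

lemma KS_action_eq_None:
  "\<tau> \<notin> topspace (KS_space X \<theta>) \<or> \<tau> (s\<^sup>\<star> * s) = None \<Longrightarrow> KS_action X \<theta> s \<tau> = None"
  by (auto simp: KS_action_def)

lemma KS_action_eq_Some:
  assumes \<tau>: "\<tau> \<in> topspace (KS_space X \<theta>)" and x: "\<tau> (s\<^sup>\<star> * s) = Some x" and y: "\<theta> s x = Some y"
  shows "KS_action X \<theta> s \<tau> = Some (transported s y \<tau>)"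
proof -
  have \<tau>': "\<tau> \<in> KS_tilde X \<theta>"
    using \<tau> KS_space_iff by blast
  have "(case \<tau> (s\<^sup>\<star> * e * s) of None \<Rightarrow> None | Some x \<Rightarrow> \<theta> (e * s) x) =
      (if \<tau> (s\<^sup>\<star> * e * s) = None then None else Some y)" if e: "e \<in> idempotents" for e
  proof (cases "\<tau> (s\<^sup>\<star> * e * s)")
    case (Some x')
    then have "x' = x"
      using KS_tilde_conjugate_le[OF \<tau>' e Some] x by simp
    then have "x \<in> act_dom \<theta> (s\<^sup>\<star> * e * s)"
      using KS_tilde_dom[OF \<tau>' conjugate_idempotent[OF e] Some] by simp
    then have "\<theta> e y = Some y"
      unfolding act_dom_conjugate[OF e] using y by (simp add: act_dom_def)
    then show ?thesis
      using Some \<open>x' = x\<close> y by (simp add: act_mult)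
  qed simp
  then show ?thesis
    using \<tau> x by (simp add: KS_action_def transported_def cong: restrict_cong)
qed

lemma KS_action_cases:
  assumes "KS_action X \<theta> s \<tau> = Some \<sigma>"
  obtains x y where "\<tau> \<in> topspace (KS_space X \<theta>)" "\<tau> (s\<^sup>\<star> * s) = Some x" "\<theta> s x = Some y"
    "\<sigma> = transported s y \<tau>"
proof -
  have \<tau>: "\<tau> \<in> topspace (KS_space X \<theta>)" "\<tau> (s\<^sup>\<star> * s) \<noteq> None"
    using assms KS_action_eq_None by (metis option.distinct(1))+
  then obtain x where x: "\<tau> (s\<^sup>\<star> * s) = Some x"
    by blast
  obtain y where y: "\<theta> s x = Some y"
    using KS_tilde_act_defined[of \<tau>, OF _ x] \<tau>(1) KS_space_iff by blast
  show ?thesis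
    using that[OF \<tau>(1) x y] KS_action_eq_Some[OF \<tau>(1) x y] assms by simp
qed

lemma transported_in_KS_space:
  assumes \<tau>: "\<tau> \<in> topspace (KS_space X \<theta>)" and x: "\<tau> (s\<^sup>\<star> * s) = Some x" and y: "\<theta> s x = Some y"
  shows "transported s y \<tau> \<in> topspace (KS_space X \<theta>)"
proof -
  have \<tau>': "\<tau> \<in> KS_tilde X \<theta>"
    using \<tau> KS_space_iff by blast
  have "transported s y \<tau> \<in> KS_tilde X \<theta>"
  proof (rule KS_tildeI)
    show "transported s y \<tau> \<in> extensional idempotents"
      by (simp add: transported_def)
  next
    fix e z assume e: "e \<in> idempotents" and "transported s y \<tau> e = Some z"
    then obtain x' where x': "\<tau> (s\<^sup>\<star> * e * s) = Some x'" "z = y"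
      by (auto simp: transported_eq split: if_splits)
    then have "\<tau> (s\<^sup>\<star> * e * s) = Some x"
      using KS_tilde_conjugate_le[OF \<tau>' e x'(1)] x by simp
    then show "z \<in> act_dom \<theta> e"
      using KS_tilde_dom[OF \<tau>' conjugate_idempotent[OF e]] act_dom_conjugate[OF e, of x s] y x'(2)
      by auto
  next
    fix e f :: 's assume e: "e \<in> idempotents" and f: "f \<in> idempotents"
    have "\<tau> (s\<^sup>\<star> * (e * f) * s) \<noteq> None \<longleftrightarrow> \<tau> (s\<^sup>\<star> * e * s) \<noteq> None \<and> \<tau> (s\<^sup>\<star> * f * s) \<noteq> None"
      unfolding conjugate_mult[OF e, symmetric]
      using KS_tilde_mult_iff[OF \<tau>' conjugate_idempotent[OF e] conjugate_idempotent[OF f], of s s]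
        KS_tildeD(3)[OF \<tau>' conjugate_idempotent[OF e] conjugate_idempotent[OF f], of s s]
      by auto
    then show "transported s y \<tau> (e * f) \<noteq> None \<longleftrightarrow>
        transported s y \<tau> e \<noteq> None \<and> transported s y \<tau> f \<noteq> None"
      using e f idempotent_mult[OF e f] by (auto simp: transported_eq)
  next
    fix e f :: 's and z w
    assume "e \<in> idempotents" "f \<in> idempotents" "transported s y \<tau> e = Some z"
      "transported s y \<tau> f = Some w"
    then show "z = w"
      by (auto simp: transported_eq split: if_splits)
  qed
  moreover have "transported s y \<tau> (s * s\<^sup>\<star>) \<noteq> None"
    using x by (simp add: transported_eq star_mult_idempotent star_inverse_left mult.assoc)
  ultimately show ?thesis
    using KS_space_iff star_mult_idempotent(2) by blast
qed

lemma KS_action_mult: "KS_action X \<theta> (s * t) \<tau> = (KS_action X \<theta> s \<circ>\<^sub>m KS_action X \<theta> t) \<tau>"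
proof (cases "\<tau> \<in> topspace (KS_space X \<theta>)")
  case False
  then show ?thesis
    by (simp add: KS_action_eq_None map_comp_def)
next
  case \<tau>: True
  then have \<tau>': "\<tau> \<in> KS_tilde X \<theta>"
    using KS_space_iff by blast
  have st: "(s * t)\<^sup>\<star> * (s * t) = t\<^sup>\<star> * (s\<^sup>\<star> * s) * t"
    by (simp add: star_mult mult.assoc)
  show ?thesis
  proof (cases "\<tau> (t\<^sup>\<star> * s\<^sup>\<star> * s * t)")
    case None
    have "KS_action X \<theta> s \<sigma> = None" if t: "KS_action X \<theta> t \<tau> = Some \<sigma>" for \<sigma>
    proof -
      obtain y where "\<sigma> = transported t y \<tau>"
        using t by (rule KS_action_cases)
      then have "\<sigma> (s\<^sup>\<star> * s) = None"
        using None by (simp add: transported_eq star_mult_idempotent mult.assoc)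
      then show ?thesis
        by (simp add: KS_action_eq_None)
    qed
    moreover have "KS_action X \<theta> (s * t) \<tau> = None"
      using None st by (intro KS_action_eq_None) (simp add: mult.assoc)
    ultimately show ?thesis
      by (auto simp: map_comp_def split: option.splits)
  next
    case (Some x)
    then have 1: "\<tau> (t\<^sup>\<star> * (s\<^sup>\<star> * s) * t) = Some x"
      by (simp add: mult.assoc)
    then have x: "\<tau> (t\<^sup>\<star> * t) = Some x"
      by (rule KS_tilde_conjugate_le[OF \<tau>' star_mult_idempotent(1)])
    then obtain y where y: "\<theta> t x = Some y"
      by (rule KS_tilde_act_defined[OF \<tau>'])
    let ?\<sigma> = "transported t y \<tau>"
    have t: "KS_action X \<theta> t \<tau> = Some ?\<sigma>" and \<sigma>: "?\<sigma> \<in> topspace (KS_space X \<theta>)"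
      using KS_action_eq_Some transported_in_KS_space \<tau> x y by blast+
    have \<sigma>s: "?\<sigma> (s\<^sup>\<star> * s) = Some y"
      using 1 by (simp add: transported_eq star_mult_idempotent)
    then obtain v where v: "\<theta> s y = Some v"
      using \<sigma> KS_space_iff by (blast elim: KS_tilde_act_defined)
    have "\<theta> (s * t) x = Some v"
      using y v by (simp add: act_mult)
    then have "KS_action X \<theta> (s * t) \<tau> = Some (transported (s * t) v \<tau>)"
      using KS_action_eq_Some[OF \<tau>] 1 st by simp
    moreover have "transported (s * t) v \<tau> = transported s v ?\<sigma>"
    proof -
      have "transported (s * t) v \<tau> e = transported s v ?\<sigma> e" if "e \<in> idempotents" for e
      proof -
        have "(s * t)\<^sup>\<star> * e * (s * t) = t\<^sup>\<star> * (s\<^sup>\<star> * e * s) * t"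
          by (simp add: star_mult mult.assoc)
        then show ?thesis
          by (simp add: transported_eq[OF that] transported_eq[OF conjugate_idempotent[OF that]])
      qed
      then show ?thesis
        by (auto simp: transported_def fun_eq_iff)
    qed
    ultimately show ?thesis
      using t KS_action_eq_Some[OF \<sigma> \<sigma>s v] by (simp add: map_comp_def)
  qed
qed

text \<open>Since \<open>\<tau>(e)\<close> is finite, \<open>\<tau>(e f)\<close> is finite exactly when \<open>\<tau>(f)\<close> is.\<close>

lemma KS_action_idempotent:
  assumes \<tau>: "\<tau> \<in> topspace (KS_space X \<theta>)" and e: "e \<in> idempotents" and "\<tau> e \<noteq> None"
  shows "KS_action X \<theta> e \<tau> = Some \<tau>"
proof -
  have \<tau>': "\<tau> \<in> KS_tilde X \<theta>"
    using \<tau> KS_space_iff by blast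
  obtain x where x: "\<tau> e = Some x"
    using assms(3) by blast
  have ee: "e\<^sup>\<star> * e = e"
    using e by (simp add: star_idempotent idempotent_mult_self)
  have ex: "\<theta> e x = Some x"
    using KS_tilde_dom[OF \<tau>' e x] by (simp add: act_dom_def)
  have "transported e x \<tau> f = \<tau> f" if f: "f \<in> idempotents" for f
  proof -
    have "e\<^sup>\<star> * f * e = e * f"
      using idempotent_mult_cancel[OF e, of f]
      by (simp only: star_idempotent[OF e] mult.assoc idempotent_commute[OF f e])
    then have c: "transported e x \<tau> f = (if \<tau> (e * f) = None then None else Some x)"
      using f by (simp add: transported_eq)
    show ?thesis
    proof (cases "\<tau> f")
      case None
      then have "\<tau> (e * f) = None"
        using KS_tilde_mult_iff[OF \<tau>' e f] by (cases "\<tau> (e * f)") auto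
      then show ?thesis
        using c None by simp
    next
      case (Some y)
      moreover have "x = y"
        using KS_tilde_value_unique[OF \<tau>' e f x Some] .
      ultimately show ?thesis
        using c KS_tilde_mult_iff[OF \<tau>' e f, of x] x by simp
    qed
  qed
  moreover have "transported e x \<tau> f = \<tau> f" if "f \<notin> idempotents" for f
    using that KS_tilde_extensional[OF \<tau>'] by (auto simp: transported_def extensional_def)
  ultimately have "transported e x \<tau> = \<tau>"
    by blast
  then show ?thesis
    using KS_action_eq_Some[OF \<tau> _ ex] x ee by simp
qed

lemma act_dom_KS_action:
  assumes e: "e \<in> idempotents"
  shows "act_dom (KS_action X \<theta>) e = {\<tau> \<in> topspace (KS_space X \<theta>). \<tau> e \<noteq> None}"
proof -
  have "e\<^sup>\<star> * e = e"
    using e by (simp add: star_idempotent idempotent_mult_self)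
  then have "\<tau> \<in> act_dom (KS_action X \<theta>) e \<longleftrightarrow> \<tau> \<in> topspace (KS_space X \<theta>) \<and> \<tau> e \<noteq> None" for \<tau>
    using KS_action_idempotent[of \<tau>, OF _ e] KS_action_eq_None[of \<tau> e]
    unfolding act_dom_def mem_Collect_eq by force
  then show ?thesis
    by blast
qed

lemma act_dom_KS_action_Some:
  assumes e: "e \<in> idempotents"
  shows "act_dom (KS_action X \<theta>) e = {\<tau> \<in> topspace (KS_space X \<theta>). \<tau> e \<in> Some ` act_dom \<theta> e}"
  unfolding act_dom_KS_action[OF e] using KS_space_iff KS_tilde_dom[OF _ e] by auto

lemma KS_action_inj:
  assumes "KS_action X \<theta> s \<tau> = Some \<rho>" "KS_action X \<theta> s \<sigma> = Some \<rho>"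
  shows "\<tau> = \<sigma>"
proof -
  have "KS_action X \<theta> (s\<^sup>\<star> * s) \<tau> = KS_action X \<theta> (s\<^sup>\<star> * s) \<sigma>"
    using assms by (simp add: KS_action_mult)
  moreover have "KS_action X \<theta> (s\<^sup>\<star> * s) \<kappa> = Some \<kappa>" if "KS_action X \<theta> s \<kappa> = Some \<rho>" for \<kappa>
    using that KS_action_idempotent[OF _ star_mult_idempotent(1)] by (auto elim: KS_action_cases)
  ultimately show ?thesis
    using assms by simp
qed

lemma openin_KS_act_dom:
  "e \<in> idempotents \<Longrightarrow> openin (KS_space X \<theta>) (act_dom (KS_action X \<theta>) e)"
  using act_dom_KS_action_Some openin_KS_space_Some openin_act_dom by simp

abbreviation KS_domain :: "'s \<Rightarrow> ('s \<Rightarrow> 'x option) topology"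
  where "KS_domain s \<equiv> subtopology (KS_space X \<theta>) (act_dom (KS_action X \<theta>) (s\<^sup>\<star> * s))"

lemma topspace_KS_domain:
  "topspace (KS_domain s) = {\<tau> \<in> topspace (KS_space X \<theta>). \<tau> (s\<^sup>\<star> * s) \<noteq> None}"
  by (auto simp: act_dom_KS_action star_mult_idempotent)

lemma openin_KS_domain_Some:
  assumes "e \<in> idempotents" "openin X U" "U \<subseteq> act_dom \<theta> e"
  shows "openin (KS_domain s) {\<tau> \<in> topspace (KS_domain s). \<tau> e \<in> Some ` U}"
proof -
  have "{\<tau> \<in> topspace (KS_domain s). \<tau> e \<in> Some ` U} =
      {\<tau> \<in> topspace (KS_space X \<theta>). \<tau> e \<in> Some ` U} \<inter> act_dom (KS_action X \<theta>) (s\<^sup>\<star> * s)"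
    by auto
  then show ?thesis
    using openin_KS_space_Some[OF assms] by (auto simp: openin_subtopology)
qed

lemma closedin_KS_domain_Some:
  assumes "e \<in> idempotents" "compactin X L" "L \<subseteq> act_dom \<theta> e"
  shows "closedin (KS_domain s) {\<tau> \<in> topspace (KS_domain s). \<tau> e \<in> Some ` L}"
proof -
  have "{\<tau> \<in> topspace (KS_domain s). \<tau> e \<in> Some ` L} =
      {\<tau> \<in> topspace (KS_space X \<theta>). \<tau> e \<in> Some ` L} \<inter> act_dom (KS_action X \<theta>) (s\<^sup>\<star> * s)"
    by auto
  then show ?thesis
    using closedin_KS_space_Some[OF assms] by (auto simp: closedin_subtopology)
qed

text \<open>The common value of the finite coordinates of \<open>\<theta>\<^sub>s \<tau>\<close>.\<close>

definition image_value :: "'s \<Rightarrow> ('s \<Rightarrow> 'x option) \<Rightarrow> 'x"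
  where "image_value s \<tau> = the (\<theta> s (the (\<tau> (s\<^sup>\<star> * s))))"

lemma KS_domainE:
  assumes "\<tau> \<in> topspace (KS_domain s)"
  obtains x where "\<tau> \<in> topspace (KS_space X \<theta>)" "\<tau> \<in> KS_tilde X \<theta>" "\<tau> (s\<^sup>\<star> * s) = Some x"
    "\<theta> s x = Some (image_value s \<tau>)" "KS_action X \<theta> s \<tau> = Some (transported s (image_value s \<tau>) \<tau>)"
proof -
  obtain x where 1: "\<tau> \<in> topspace (KS_space X \<theta>)" "\<tau> (s\<^sup>\<star> * s) = Some x"
    using assms topspace_KS_domain by blast
  then have 2: "\<tau> \<in> KS_tilde X \<theta>"
    using KS_space_iff by blast
  obtain y where y: "\<theta> s x = Some y"
    using KS_tilde_act_defined[OF 2 1(2)] .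
  have "y = image_value s \<tau>"
    by (simp add: image_value_def 1(2) y)
  then show ?thesis
    using that[OF 1(1) 2 1(2)] KS_action_eq_Some[OF 1 y] y by simp
qed

lemma continuous_map_image_value: "continuous_map (KS_domain s) X (image_value s)"
proof -
  note E = star_mult_idempotent(1)[of s]
  have val: "the (\<tau> (s\<^sup>\<star> * s)) \<in> act_dom \<theta> (s\<^sup>\<star> * s)" if "\<tau> \<in> topspace (KS_domain s)" for \<tau>
    using KS_domainE[OF that] KS_tilde_dom[OF _ E] by (metis option.sel)
  have "openin (KS_domain s) {\<tau> \<in> topspace (KS_domain s). the (\<tau> (s\<^sup>\<star> * s)) \<in> U}" if "openin X U" for U
  proof -
    have "{\<tau> \<in> topspace (KS_domain s). the (\<tau> (s\<^sup>\<star> * s)) \<in> U} =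
        {\<tau> \<in> topspace (KS_domain s). \<tau> (s\<^sup>\<star> * s) \<in> Some ` (U \<inter> act_dom \<theta> (s\<^sup>\<star> * s))}" (is "?L = ?R")
    proof -
      have "the (\<tau> (s\<^sup>\<star> * s)) \<in> U \<longleftrightarrow> \<tau> (s\<^sup>\<star> * s) \<in> Some ` (U \<inter> act_dom \<theta> (s\<^sup>\<star> * s))"
        if \<tau>: "\<tau> \<in> topspace (KS_domain s)" for \<tau>
      proof -
        obtain x where "\<tau> (s\<^sup>\<star> * s) = Some x"
          using \<tau> by (rule KS_domainE)
        then show ?thesis
          using val[OF \<tau>] by auto
      qed
      then show ?thesis
        by blast
    qed
    then show ?thesis
      using openin_KS_domain_Some[OF E openin_Int[OF that openin_act_dom[OF E]], of s] by simp
  qed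
  then have "continuous_map (KS_domain s) (subtopology X (act_dom \<theta> (s\<^sup>\<star> * s))) (\<lambda>\<tau>. the (\<tau> (s\<^sup>\<star> * s)))"
    unfolding continuous_map_in_subtopology using val act_dom_subset
    by (auto simp: continuous_map_def Pi_iff subset_iff)
  from continuous_map_compose[OF this continuous_act] show ?thesis
    by (simp add: o_def image_value_def[abs_def])
qed

text \<open>Write \<open>q\<close> for the common value of the image, which depends continuously on \<open>\<tau>\<close>.  The delicate case
  is that the coordinate \<open>s\<^sup>\<star> e s\<close> of \<open>\<tau>\<close> is infinite: for compact \<open>C \<subseteq> X\<^sub>e\<close>, a nearby point must not have
  a finite coordinate there and \<open>q \<in> C\<close>.  It is not enough that \<open>\<theta>\<^sub>s\<close> is a homeomorphism from
  \<open>X\<^bsub>s* e s\<^esub>\<close> to \<open>X\<^bsub>e s s*\<^esub>\<close>, since points that leave the compact sets of \<open>X\<^bsub>e s s*\<^esub>\<close> can stay in a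
  compact set of \<open>X\<^sub>e\<close>.  But \<open>q\<close> stays in a compact neighbourhood \<open>L \<subseteq> X\<^bsub>s s*\<^esub>\<close> of its value at \<open>\<tau>\<close>, so only
  the compact set \<open>C \<inter> L \<subseteq> X\<^bsub>e s s*\<^esub>\<close> matters, and its preimage under \<open>\<theta>\<^sub>s\<close> can be avoided.\<close>

lemma continuous_map_transported_coordinate:
  assumes e: "e \<in> idempotents"
  shows "continuous_map (KS_domain s) (compactified e)
    (\<lambda>\<tau>. if \<tau> (s\<^sup>\<star> * e * s) = None then None else Some (image_value s \<tau>))" (is "continuous_map _ _ ?g")
  unfolding continuous_map_def
proof (intro conjI allI impI)
  let ?D = "KS_domain s" and ?q = "image_value s"
  note c = conjugate_idempotent[OF e, of s]
  have same: "\<theta> s x = Some (?q \<tau>)" and conj: "x \<in> act_dom \<theta> (s\<^sup>\<star> * e * s)"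
    and dom: "?q \<tau> \<in> act_dom \<theta> e"
    if \<tau>: "\<tau> \<in> topspace ?D" "\<tau> (s\<^sup>\<star> * e * s) = Some x" for \<tau> x
  proof -
    obtain x' where x': "\<tau> \<in> KS_tilde X \<theta>" "\<tau> (s\<^sup>\<star> * s) = Some x'" "\<theta> s x' = Some (?q \<tau>)"
      using \<tau>(1) by (rule KS_domainE)
    then have "x' = x"
      using KS_tilde_conjugate_le[OF x'(1) e \<tau>(2)] by simp
    then show "\<theta> s x = Some (?q \<tau>)"
      using x' by simp
    show "x \<in> act_dom \<theta> (s\<^sup>\<star> * e * s)"
      using KS_tilde_dom[OF x'(1) c \<tau>(2)] .
    then show "?q \<tau> \<in> act_dom \<theta> e"
      using act_dom_conjugate[OF e] \<open>\<theta> s x = Some (?q \<tau>)\<close> by auto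
  qed
  show "?g \<in> topspace ?D \<rightarrow> topspace (compactified e)"
  proof
    fix \<tau> assume "\<tau> \<in> topspace ?D"
    then show "?g \<tau> \<in> topspace (compactified e)"
      using dom[of \<tau>] act_dom_subset[of e] by (cases "\<tau> (s\<^sup>\<star> * e * s)") auto
  qed
  have q_open: "openin ?D {\<tau> \<in> topspace ?D. ?q \<tau> \<in> U}" if "openin X U" for U
    using openin_continuous_map_preimage[OF continuous_map_image_value that] .
  fix A assume "openin (compactified e) A"
  then consider (fin) U where "openin X U" "A = Some ` U"
    | (inf) C where "compactin X C" "C \<subseteq> act_dom \<theta> e" "A = insert None (Some ` (act_dom \<theta> e - C))"
    unfolding openin_Alexandroff_compactification compactin_subtopology
      openin_open_subtopology[OF openin_act_dom[OF e]]
    using act_dom_subset[of e] by (auto simp: inf_absorb2)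
  then show "openin ?D {\<tau> \<in> topspace ?D. ?g \<tau> \<in> A}"
  proof cases
    case fin
    have "{\<tau> \<in> topspace ?D. ?g \<tau> \<in> A} = {\<tau> \<in> topspace ?D. ?q \<tau> \<in> U} \<inter>
        {\<tau> \<in> topspace ?D. \<tau> (s\<^sup>\<star> * e * s) \<in> Some ` act_dom \<theta> (s\<^sup>\<star> * e * s)}"
      using fin(2) conj by auto
    then show ?thesis
      using q_open[OF fin(1)] openin_KS_domain_Some[OF c openin_act_dom[OF c]] by auto
  next
    case inf
    have eq: "{\<tau> \<in> topspace ?D. ?g \<tau> \<in> A} = {\<tau> \<in> topspace ?D. \<tau> (s\<^sup>\<star> * e * s) = None \<or> ?q \<tau> \<notin> C}"
      using inf(3) dom by auto
    show ?thesis
      unfolding eq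
    proof (subst openin_subopen, intro ballI)
      fix \<tau> assume \<tau>: "\<tau> \<in> {\<tau> \<in> topspace ?D. \<tau> (s\<^sup>\<star> * e * s) = None \<or> ?q \<tau> \<notin> C}"
      show "\<exists>T. openin ?D T \<and> \<tau> \<in> T \<and> T \<subseteq> {\<tau> \<in> topspace ?D. \<tau> (s\<^sup>\<star> * e * s) = None \<or> ?q \<tau> \<notin> C}"
      proof (cases "?q \<tau> \<in> C")
        case False
        have "openin X (topspace X - C)"
          using compactin_imp_closedin[OF Hausdorff inf(1)] by blast
        from q_open[OF this] show ?thesis
          using False \<tau> continuous_map_image_value[of s]
          by (intro exI[of _ "{\<tau> \<in> topspace ?D. ?q \<tau> \<in> topspace X - C}"]) (auto simp: continuous_map_def)
      next
        case True
        with \<tau> have None: "\<tau> (s\<^sup>\<star> * e * s) = None" and \<tau>D: "\<tau> \<in> topspace ?D"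
          by auto
        have "?q \<tau> \<in> act_dom \<theta> (s * s\<^sup>\<star>)"
          using \<tau>D by (rule KS_domainE) (rule act_dom_range)
        then obtain U L where UL: "openin X U" "compactin X L" "?q \<tau> \<in> U" "U \<subseteq> L" "L \<subseteq> act_dom \<theta> (s * s\<^sup>\<star>)"
          using compact_neighbourhood[OF openin_act_dom[OF star_mult_idempotent(2)]] by blast
        define M where "M = (\<lambda>w. the (\<theta> (s\<^sup>\<star>) w)) ` (C \<inter> L)"
        have "compactin X (C \<inter> L)"
          using closed_Int_compactin[OF compactin_imp_closedin[OF Hausdorff inf(1)] UL(2)] .
        then have "compactin X M"
          unfolding M_def using continuous_act[of "s\<^sup>\<star>"] UL(5)
          by (intro image_compactin[of "subtopology X (act_dom \<theta> (s * s\<^sup>\<star>))"])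
            (auto simp: compactin_subtopology)
        moreover have "M \<subseteq> act_dom \<theta> (s\<^sup>\<star> * e * s)"
        proof -
          have "the (\<theta> (s\<^sup>\<star>) w) \<in> act_dom \<theta> (s\<^sup>\<star> * e * s)" if w: "w \<in> C" "w \<in> L" for w
          proof -
            obtain z where "\<theta> (s\<^sup>\<star>) w = Some z"
              using w(2) UL(5) act_dom_iff[of w "s\<^sup>\<star>"] by auto
            then show ?thesis
              using act_star_iff[of s w z] act_dom_conjugate[OF e] w(1) inf(2) by auto
          qed
          then show ?thesis
            by (auto simp: M_def)
        qed
        ultimately have "openin ?D ({\<tau> \<in> topspace ?D. ?q \<tau> \<in> U}
            - {\<tau> \<in> topspace ?D. \<tau> (s\<^sup>\<star> * e * s) \<in> Some ` M})" (is "openin _ ?T")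
          using q_open[OF UL(1)] closedin_KS_domain_Some[OF c] by (intro openin_diff) auto
        moreover have "\<sigma> (s\<^sup>\<star> * e * s) = None \<or> ?q \<sigma> \<notin> C" if "\<sigma> \<in> ?T" for \<sigma>
        proof (rule ccontr)
          assume "\<not> ?thesis"
          then obtain x where x: "\<sigma> (s\<^sup>\<star> * e * s) = Some x" "?q \<sigma> \<in> C"
            by auto
          then have "\<theta> (s\<^sup>\<star>) (?q \<sigma>) = Some x"
            using same that act_star by blast
          then have "x \<in> M"
            unfolding M_def using x(2) that UL(4) by (intro image_eqI[of _ _ "?q \<sigma>"]) auto
          then show False
            using that x by blast
        qed
        ultimately have "?T \<subseteq> {\<tau> \<in> topspace ?D. \<tau> (s\<^sup>\<star> * e * s) = None \<or> ?q \<tau> \<notin> C}"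
          and "openin ?D ?T"
          by blast+
        moreover have "\<tau> \<in> ?T"
          using None \<tau>D UL(3) by auto
        ultimately show ?thesis
          by blast
      qed
    qed
  qed
qed

lemma continuous_map_KS_action:
  "continuous_map (KS_domain s) (subtopology (KS_space X \<theta>) (act_dom (KS_action X \<theta>) (s * s\<^sup>\<star>)))
    (\<lambda>\<tau>. the (KS_action X \<theta> s \<tau>))"
proof -
  have 1: "the (KS_action X \<theta> s \<tau>) \<in> act_dom (KS_action X \<theta>) (s * s\<^sup>\<star>)"
    if \<tau>: "\<tau> \<in> topspace (KS_domain s)" for \<tau>
  proof -
    obtain x where x: "\<tau> \<in> topspace (KS_space X \<theta>)" "\<tau> (s\<^sup>\<star> * s) = Some x"
      "\<theta> s x = Some (image_value s \<tau>)" "KS_action X \<theta> s \<tau> = Some (transported s (image_value s \<tau>) \<tau>)"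
      using \<tau> by (rule KS_domainE)
    have "transported s (image_value s \<tau>) \<tau> (s * s\<^sup>\<star>) \<noteq> None"
      using x by (simp add: transported_eq star_mult_idempotent star_inverse_left mult.assoc)
    then show ?thesis
      using transported_in_KS_space[OF x(1-3)] x(4) by (simp add: act_dom_KS_action star_mult_idempotent)
  qed
  have "continuous_map (KS_domain s) (KS_product X \<theta>) (\<lambda>\<tau>. transported s (image_value s \<tau>) \<tau>)"
    unfolding KS_product_def continuous_map_componentwise
    using continuous_map_transported_coordinate[of _ s]
    by (auto simp: transported_def)
  then have "continuous_map (KS_domain s) (KS_product X \<theta>) (\<lambda>\<tau>. the (KS_action X \<theta> s \<tau>))"
    by (rule continuous_map_eq) (erule KS_domainE, simp)
  moreover have "act_dom (KS_action X \<theta>) (s * s\<^sup>\<star>) \<subseteq> KS_tilde X \<theta> - {KS_infinity}"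
    unfolding topspace_KS_space[symmetric] by (auto simp: act_dom_KS_action star_mult_idempotent)
  ultimately show ?thesis
    using 1 unfolding continuous_map_in_subtopology KS_space_def subtopology_subtopology
    by (auto simp: KS_space_def)
qed

theorem inverse_semigroup_action_KS_action:
  "inverse_semigroup_action (KS_space X \<theta>) (KS_action X \<theta>)"
  unfolding inverse_semigroup_action_def
proof (intro conjI allI ballI)
  fix s
  show "partial_bijection (topspace (KS_space X \<theta>)) (KS_action X \<theta> s)"
    unfolding partial_bijection_def
  proof (intro conjI)
    show "dom (KS_action X \<theta> s) \<subseteq> topspace (KS_space X \<theta>)"
      by (auto elim: KS_action_cases)
    show "ran (KS_action X \<theta> s) \<subseteq> topspace (KS_space X \<theta>)"
      using transported_in_KS_space by (auto simp: ran_def elim!: KS_action_cases)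
    show "inj_on (KS_action X \<theta> s) (dom (KS_action X \<theta> s))"
      using KS_action_inj by (auto simp: inj_on_def)
  qed
  show "KS_action X \<theta> (s * t) = KS_action X \<theta> s \<circ>\<^sub>m KS_action X \<theta> t" for t
    using KS_action_mult by blast
next
  show "(\<Union>e\<in>idempotents. act_dom (KS_action X \<theta>) e) = topspace (KS_space X \<theta>)"
    using KS_space_iff by (auto simp: act_dom_KS_action)
qed (use openin_KS_act_dom continuous_map_KS_action in auto)

section \<open>Total disconnectedness of \<open>X\<close> and of \<open>X\<^sup>K\<^sup>S\<close>\<close>

text \<open>Here \<open>f * e = e\<close> is \<open>e \<le> f\<close>, so the finite coordinates form the principal filter of \<open>e\<close>.\<close>

definition principal_point :: "'s \<Rightarrow> 'x \<Rightarrow> 's \<Rightarrow> 'x option"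
  where "principal_point e x = (\<lambda>f\<in>idempotents. if f * e = e then Some x else None)"

lemma principal_point_in_KS_space:
  assumes e: "e \<in> idempotents" and x: "x \<in> act_dom \<theta> e"
  shows "principal_point e x \<in> topspace (KS_space X \<theta>)"
proof -
  have "principal_point e x \<in> KS_tilde X \<theta>"
  proof (rule KS_tildeI)
    fix f y assume f: "f \<in> idempotents" and "principal_point e x f = Some y"
    then have "f * e = e" "y = x"
      by (auto simp: principal_point_def split: if_splits)
    then show "y \<in> act_dom \<theta> f"
      using act_dom_mult[OF f e] x by auto
  next
    fix f g :: 's assume f: "f \<in> idempotents" and g: "g \<in> idempotents"
    have "f * g * e = e \<longleftrightarrow> f * e = e \<and> g * e = e"
    proof
      assume "f * g * e = e"
      then have fge: "f * (g * e) = e" "g * (f * e) = e"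
        using idempotent_commute[OF f g] by (simp_all flip: mult.assoc)
      then show "f * e = e \<and> g * e = e"
        using idempotent_mult_cancel[OF f, of "g * e"] idempotent_mult_cancel[OF g, of "f * e"] by simp
    qed (simp add: mult.assoc)
    then show "principal_point e x (f * g) \<noteq> None \<longleftrightarrow>
        principal_point e x f \<noteq> None \<and> principal_point e x g \<noteq> None"
      using f g idempotent_mult[OF f g] by (auto simp: principal_point_def)
  qed (auto simp: principal_point_def split: if_splits)
  moreover have "principal_point e x e \<noteq> None"
    using e by (simp add: principal_point_def idempotent_mult_self)
  ultimately show ?thesis
    using KS_space_iff e by blast
qed

text \<open>Each coordinate is constantly infinite or the inclusion \<open>X\<^sub>e \<subseteq> X\<^sub>f\<close>, as the set of finite coordinates
  does not depend on \<open>x\<close>.  If instead all \<open>f\<close> with \<open>x \<in> X\<^sub>f\<close> were given the value \<open>x\<close>,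
  continuity could fail at the boundary of \<open>X\<^sub>f\<close>.\<close>

lemma continuous_map_principal_point:
  assumes e: "e \<in> idempotents"
  shows "continuous_map (subtopology X (act_dom \<theta> e)) (KS_space X \<theta>) (principal_point e)"
proof -
  have "continuous_map (subtopology X (act_dom \<theta> e)) (compactified f) (\<lambda>x. principal_point e x f)"
    if f: "f \<in> idempotents" for f
  proof (cases "f * e = e")
    case True
    have "act_dom \<theta> e \<subseteq> act_dom \<theta> f"
      using act_dom_mult[OF f e] True by auto
    then have "continuous_map (subtopology X (act_dom \<theta> e)) (subtopology X (act_dom \<theta> f)) id"
      by (auto simp: continuous_map_in_subtopology continuous_map_from_subtopology)
    from continuous_map_compose[OF this continuous_map_Some] show ?thesis
      using f True by (simp add: principal_point_def o_def)
  next
    case False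
    then show ?thesis
      using f by (simp add: principal_point_def)
  qed
  then have "continuous_map (subtopology X (act_dom \<theta> e)) (KS_product X \<theta>) (principal_point e)"
    unfolding KS_product_def continuous_map_componentwise
    by (auto simp: principal_point_def)
  then show ?thesis
    using principal_point_in_KS_space[OF e]
    unfolding topspace_KS_space by (auto simp: KS_space_def continuous_map_in_subtopology)
qed

lemma totally_disconnected_KS_space_imp:
  assumes "totally_disconnected_space (KS_space X \<theta>)"
  shows "totally_disconnected_space X"
proof (rule totally_disconnected_space_openin_cover[OF locally_compact Hausdorff])
  show "topspace X \<subseteq> \<Union> (act_dom \<theta> ` idempotents)"
    using action_covers by blast
  fix U assume "U \<in> act_dom \<theta> ` idempotents"
  then obtain e where e: "e \<in> idempotents" "U = act_dom \<theta> e"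
    by blast
  then show "openin X U"
    using openin_act_dom by blast
  have "x = y" if "principal_point e x = principal_point e y" for x y
    using fun_cong[OF that, of e] e by (simp add: principal_point_def idempotent_mult_self)
  then show "totally_disconnected_space (subtopology X U)"
    using totally_disconnected_space_inj_preimage[OF continuous_map_principal_point[OF e(1)]] assms e
    by (auto simp: inj_on_def)
qed

text \<open>If two points of a connected set differ at \<open>e\<close>, at least one of them is finite there, and a compact
  open subset of \<open>X\<^sub>e\<close> containing its value but not the other one defines a clopen set separating them.\<close>

lemma totally_disconnected_imp_KS_space:
  assumes td: "totally_disconnected_space X"
  shows "totally_disconnected_space (KS_space X \<theta>)"
  unfolding totally_disconnected_space_def
proof (intro allI impI)
  fix C assume C: "connectedin (KS_space X \<theta>) C"
  then have CK: "C \<subseteq> KS_tilde X \<theta>"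
    using connectedin_subset_topspace KS_space_iff by blast
  have le: "\<tau> e = Some x" if \<sigma>\<tau>: "\<sigma> \<in> C" "\<tau> \<in> C" and e: "e \<in> idempotents" and x: "\<sigma> e = Some x" for \<sigma> \<tau> e x
  proof (rule ccontr)
    assume ne: "\<tau> e \<noteq> Some x"
    have xe: "x \<in> act_dom \<theta> e"
      using KS_tilde_dom[of \<sigma>, OF _ e x] CK \<sigma>\<tau> by blast
    have "finite {y. \<tau> e = Some y}"
      by (cases "\<tau> e") auto
    then have "closedin X (topspace X \<inter> {y. \<tau> e = Some y})"
      by (intro closedin_Hausdorff_finite[OF Hausdorff]) auto
    then have "openin X (act_dom \<theta> e - (topspace X \<inter> {y. \<tau> e = Some y}))"
      using openin_act_dom[OF e] by blast
    then obtain K where K: "compactin X K" "openin X K" "x \<in> K"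
        "K \<subseteq> act_dom \<theta> e - (topspace X \<inter> {y. \<tau> e = Some y})"
      using totally_disconnected_imp_compact_open_base[OF locally_compact Hausdorff td] xe ne by blast
    let ?T = "{\<rho> \<in> topspace (KS_space X \<theta>). \<rho> e \<in> Some ` K}"
    have "closedin (KS_space X \<theta>) ?T" "openin (KS_space X \<theta>) ?T"
      using closedin_KS_space_Some[OF e K(1)] openin_KS_space_Some[OF e K(2)] K(4) by auto
    then have "C \<subseteq> ?T \<or> disjnt C ?T"
      using connectedin_clopen_cases[OF C] by blast
    moreover have "\<sigma> \<in> ?T"
      using \<sigma>\<tau> x K(3) connectedin_subset_topspace[OF C] by auto
    ultimately have "\<tau> e \<in> Some ` K"
      using \<sigma>\<tau> by (auto simp: disjnt_iff)
    then show False
      using K(4) act_dom_subset by blast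
  qed
  have "\<sigma> = \<tau>" if "\<sigma> \<in> C" "\<tau> \<in> C" for \<sigma> \<tau>
  proof (rule extensionalityI)
    show "\<sigma> \<in> extensional idempotents" "\<tau> \<in> extensional idempotents"
      using that CK KS_tilde_extensional by blast+
    show "\<sigma> e = \<tau> e" if "e \<in> idempotents" for e
      using le[OF \<open>\<sigma> \<in> C\<close> \<open>\<tau> \<in> C\<close> that] le[OF \<open>\<tau> \<in> C\<close> \<open>\<sigma> \<in> C\<close> that]
      by (cases "\<sigma> e"; cases "\<tau> e") auto
  qed
  then show "\<exists>\<tau>. C \<subseteq> {\<tau>}"
    by blast
qed

end

theorem proposition3p1p6:
  fixes X :: "'x topology"
    and \<theta> :: "'s::inverse_semigroup \<Rightarrow> 'x \<rightharpoonup> 'x"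
  assumes "locally_compact_space X"
    and "Hausdorff_space X"
    and "inverse_semigroup_action X \<theta>"
  shows "ample_groupoid (KS_groupoid X \<theta>) \<longleftrightarrow> totally_disconnected_space X"
proof -
  interpret lch_action X \<theta>
    using assms by unfold_locales
  have "ample_groupoid (KS_groupoid X \<theta>) \<longleftrightarrow> totally_disconnected_space (KS_space X \<theta>)"
    unfolding KS_groupoid_def
    by (rule ample_transformation_groupoid_iff[OF inverse_semigroup_action_KS_action
          locally_compact_KS_space Hausdorff_KS_space])
  also have "\<dots> \<longleftrightarrow> totally_disconnected_space X"
    using totally_disconnected_KS_space_imp totally_disconnected_imp_KS_space by blast
  finally show ?thesis .
qed

end
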